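(* Let $m\ge1$, $n\ge1$. Every cominuscule parabolic set of roots $P$ of $\mathfrak{g}=\mathfrak{osp}(2m+1|2n)$ is conjugate under the action of the Weyl group $W_{\mathfrak{so}(2m+1)}\times W_{\mathfrak{sp}(2n)}$ of $\mathfrak{g}_{\bar0}$ to $P_{\mathfrak{osp}(2m+1|2n)}$ (which is itself cominuscule parabolic). For the Levi subalgebra and nilradical of the corresponding parabolic subalgebra, $\mathfrak{l}\cong\mathfrak{osp}(2m-1|2n)\oplus\mathbb{C}$ and $\mathfrak{n}^+\cong V^{2m-1|2n}$ as an $\mathfrak{l}$-module.
   Context: $\mathfrak{g}_{\bar0}\cong\mathfrak{so}(2m+1)\oplus\mathfrak{sp}(2n)$, $\mathfrak{h}$ is the standard Cartan subalgebra, and $\Delta=\{\pm\varepsilon_i\pm\varepsilon_j,\ \pm\varepsilon_i,\ \pm\delta_k\pm\delta_l,\ \pm2\delta_k\mid i\neq j,\ k\ne l\}\sqcup\{\pm\varepsilon_i\pm\delta_k,\ \pm\delta_k\}$, with $1\le i,j\le m$, $1\le k,l\le n$ (first set even roots, second set odd roots). The Weyl group acts by signed permutations of the $\varepsilon_i$ and of the $\delta_k$. A proper subset $P\subsetneq\Delta$ is parabolic if $\Delta=P\cup(-P)$ and ($\alpha,\beta\in P$, $\alpha+\beta\in\Delta$ imply $\alpha+\beta\in P$). Put $L=P\cap(-P)$, $N^+=P\setminus(-P)$, $\mathfrak{p}_P=\mathfrak{h}\oplus\bigoplus_{\alpha\in P}\mathfrak{g}^\alpha$, Levi subalgebra $\mathfrak{l}=\mathfrak{h}\oplus\bigoplus_{\alpha\in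 L}\mathfrak{g}^\alpha$, nilradical $\mathfrak{n}^+=\bigoplus_{\alpha\in N^+}\mathfrak{g}^\alpha$. $P$ is cominuscule if $\mathfrak{n}^+$ is abelian. $P_{\mathfrak{osp}(2m+1|2n)}=L\sqcup N^+$ with $L=\{\pm\varepsilon_i\pm\varepsilon_j,\ \pm\varepsilon_i\mid i\neq j,\ i,j>1\}\sqcup\{\pm\delta_k\pm\delta_l,\ \pm2\delta_k\mid k\neq l\}\sqcup\{\pm\delta_k,\ \pm\varepsilon_i\pm\delta_k\mid i>1\}$ and $N^+=\{\varepsilon_1\pm\varepsilon_j,\ \varepsilon_1\mid j>1\}\sqcup\{\varepsilon_1\pm\delta_k\mid k\ge1\}$. $V^{p|q}$ is the standard representation; the summand $\mathbb{C}$ of $\mathfrak{l}$ acts on it by scalars. *)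

theory Defs
  imports
    Complex_Main
    "HOL-Library.Function_Algebras"
    "HOL-Combinatorics.Permutations"
    "Jordan_Normal_Form.Matrix"
begin

section \<open>Superspaces, Lie superalgebras and supermodules over the complex numbers\<close>

text \<open>Parities are the natural numbers 0 (even) and 1 (odd); \<open>hpart S a\<close> is the set of
  homogeneous elements of parity \<open>a\<close> (including zero).\<close>

record 'a superspace =
  scarrier :: "'a set"
  hpart :: "nat \<Rightarrow> 'a set"
  sadd :: "'a \<Rightarrow> 'a \<Rightarrow> 'a"
  sscale :: "complex \<Rightarrow> 'a \<Rightarrow> 'a"

record 'a lie_superalgebra = "'a superspace" +
  bracket :: "'a \<Rightarrow> 'a \<Rightarrow> 'a"

definition superspace_iso ::
    "('a, 'r) superspace_scheme \<Rightarrow> ('b, 's) superspace_scheme \<Rightarrow> ('a \<Rightarrow> 'b) \<Rightarrow> bool" where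
  "superspace_iso V W f \<longleftrightarrow>
     bij_betw f (scarrier V) (scarrier W) \<and>
     (\<forall>x\<in>scarrier V. \<forall>y\<in>scarrier V. f (sadd V x y) = sadd W (f x) (f y)) \<and>
     (\<forall>c. \<forall>x\<in>scarrier V. f (sscale V c x) = sscale W c (f x)) \<and>
     (\<forall>a\<in>{0, 1}. f ` hpart V a = hpart W a)"

definition lie_superalgebra_iso ::
    "'a lie_superalgebra \<Rightarrow> 'b lie_superalgebra \<Rightarrow> ('a \<Rightarrow> 'b) \<Rightarrow> bool" where
  "lie_superalgebra_iso A B f \<longleftrightarrow>
     superspace_iso A B f \<and>
     (\<forall>x\<in>scarrier A. \<forall>y\<in>scarrier A. f (bracket A x y) = bracket B (f x) (f y))"

text \<open>An even isomorphism between two supermodules over \<open>A\<close>, the module structures being given by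
  \<open>actV\<close> and \<open>actW\<close>; since \<open>f\<close> is even, no sign occurs.\<close>

definition supermodule_iso ::
    "'a lie_superalgebra \<Rightarrow> ('v, 'r) superspace_scheme \<Rightarrow> ('a \<Rightarrow> 'v \<Rightarrow> 'v) \<Rightarrow>
     ('w, 's) superspace_scheme \<Rightarrow> ('a \<Rightarrow> 'w \<Rightarrow> 'w) \<Rightarrow> ('v \<Rightarrow> 'w) \<Rightarrow> bool" where
  "supermodule_iso A V actV W actW f \<longleftrightarrow>
     superspace_iso V W f \<and>
     (\<forall>x\<in>scarrier A. \<forall>v\<in>scarrier V. f (actV x v) = actW x (f v))"

definition direct_sum ::
    "'a lie_superalgebra \<Rightarrow> 'b lie_superalgebra \<Rightarrow> ('a \<times> 'b) lie_superalgebra" where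
  "direct_sum A B =
     \<lparr> scarrier = scarrier A \<times> scarrier B,
       hpart = (\<lambda>a. hpart A a \<times> hpart B a),
       sadd = (\<lambda>(x, y) (x', y'). (sadd A x x', sadd B y y')),
       sscale = (\<lambda>c (x, y). (sscale A c x, sscale B c y)),
       bracket = (\<lambda>(x, y) (x', y'). (bracket A x x', bracket B y y')) \<rparr>"

definition abelian_line :: "complex lie_superalgebra" where
  "abelian_line =
     \<lparr> scarrier = UNIV,
       hpart = (\<lambda>a. if a = 0 then UNIV else {0}),
       sadd = (+),
       sscale = (*),
       bracket = (\<lambda>_ _. 0) \<rparr>"

section \<open>The orthosymplectic Lie superalgebras\<close>

text \<open>Matrices act on \<open>V\<^bsup>p|q\<^esup>\<close> with standard basis indexed by \<open>0, \<dots>, p + q - 1\<close>; the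
  first \<open>p\<close> basis vectors are even and the last \<open>q\<close> are odd.\<close>

definition idx_parity :: "nat \<Rightarrow> nat \<Rightarrow> nat" where
  "idx_parity p i = (if i < p then 0 else 1)"

definition vec_part :: "nat \<Rightarrow> nat \<Rightarrow> nat \<Rightarrow> complex vec set" where
  "vec_part p q a = {v \<in> carrier_vec (p + q). \<forall>i<p + q. idx_parity p i \<noteq> a \<longrightarrow> v $ i = 0}"

definition std_superspace :: "nat \<Rightarrow> nat \<Rightarrow> complex vec superspace" where
  "std_superspace p q =
     \<lparr> scarrier = carrier_vec (p + q),
       hpart = vec_part p q,
       sadd = (+),
       sscale = (\<cdot>\<^sub>v) \<rparr>"

definition gl_part :: "nat \<Rightarrow> nat \<Rightarrow> nat \<Rightarrow> complex mat set" where
  "gl_part p q a = {X \<in> carrier_mat (p + q) (p + q).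
     \<forall>i<p + q. \<forall>j<p + q. (idx_parity p i + idx_parity p j) mod 2 \<noteq> a \<longrightarrow> X $$ (i, j) = 0}"

definition homog_comp :: "nat \<Rightarrow> nat \<Rightarrow> nat \<Rightarrow> complex mat \<Rightarrow> complex mat" where
  "homog_comp p q a X = mat (p + q) (p + q)
     (\<lambda>(i, j). if (idx_parity p i + idx_parity p j) mod 2 = a then X $$ (i, j) else 0)"

text \<open>The bilinear extension of \<open>[X, Y] = X Y - (-1)\<^bsup>ab\<^esup> Y X\<close> for \<open>X\<close>, \<open>Y\<close> of parity
  \<open>a\<close>, \<open>b\<close>.\<close>

definition superbracket :: "nat \<Rightarrow> nat \<Rightarrow> complex mat \<Rightarrow> complex mat \<Rightarrow> complex mat" where
  "superbracket p q X Y =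
     (let X0 = homog_comp p q 0 X; X1 = homog_comp p q 1 X;
          Y0 = homog_comp p q 0 Y; Y1 = homog_comp p q 1 Y
      in X * Y - (Y0 * X0 + Y0 * X1 + Y1 * X0 - Y1 * X1))"

text \<open>Gram matrix of the even supersymmetric form, for even \<open>q\<close>: the nonzero entries sit on the
  antidiagonals of the two diagonal blocks, so that the form is symmetric on the even part, skew on
  the odd part, and the standard Cartan subalgebra of the matrix Lie superalgebra it defines
  consists of diagonal matrices.\<close>

definition form_mat :: "nat \<Rightarrow> nat \<Rightarrow> complex mat" where
  "form_mat p q = mat (p + q) (p + q) (\<lambda>(i, j).
     if i < p \<and> j < p \<and> i + j + 1 = p then 1
     else if p \<le> i \<and> p \<le> j \<and> i + j + 1 = 2 * p + q then (if i < j then 1 else - 1)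
     else 0)"

definition sform :: "nat \<Rightarrow> nat \<Rightarrow> complex vec \<Rightarrow> complex vec \<Rightarrow> complex" where
  "sform p q v w = v \<bullet> (form_mat p q *\<^sub>v w)"

definition osp_part :: "nat \<Rightarrow> nat \<Rightarrow> nat \<Rightarrow> complex mat set" where
  "osp_part p q a = {X \<in> gl_part p q a.
     \<forall>b\<in>{0, 1}. \<forall>v\<in>vec_part p q b. \<forall>w\<in>carrier_vec (p + q).
       sform p q (X *\<^sub>v v) w + (- 1) ^ (a * b) * sform p q v (X *\<^sub>v w) = 0}"

definition osp :: "nat \<Rightarrow> nat \<Rightarrow> complex mat set" where
  "osp p q = {X + Y | X Y. X \<in> osp_part p q 0 \<and> Y \<in> osp_part p q 1}"

definition sub_lsa :: "nat \<Rightarrow> nat \<Rightarrow> complex mat set \<Rightarrow> complex mat lie_superalgebra" where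
  "sub_lsa p q S =
     \<lparr> scarrier = S,
       hpart = (\<lambda>a. S \<inter> gl_part p q a),
       sadd = (+),
       sscale = (\<cdot>\<^sub>m),
       bracket = superbracket p q \<rparr>"

section \<open>Weights and roots of \<open>osp(2m+1|2n)\<close>\<close>

text \<open>An integral weight is given by its coordinates with respect to the basis
  \<open>\<epsilon>\<^sub>1, \<dots>, \<epsilon>\<^sub>m, \<delta>\<^sub>1, \<dots>, \<delta>\<^sub>n\<close> of the dual of the Cartan subalgebra. Addition and negation
  are pointwise.\<close>

datatype axis = Eps nat | Del nat

type_synonym weight = "axis \<Rightarrow> int"

definition eps :: "nat \<Rightarrow> weight" where
  "eps i = (\<lambda>x. if x = Eps i then 1 else 0)"

definition del :: "nat \<Rightarrow> weight" where
  "del k = (\<lambda>x. if x = Del k then 1 else 0)"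

definition wscale :: "int \<Rightarrow> weight \<Rightarrow> weight" (infixr "*\<^sub>w" 75) where
  "c *\<^sub>w \<alpha> = (\<lambda>x. c * \<alpha> x)"

abbreviation signs :: "int set" where "signs \<equiv> {1, - 1}"

definition even_roots :: "nat \<Rightarrow> nat \<Rightarrow> weight set" where
  "even_roots m n =
     {s *\<^sub>w eps i + t *\<^sub>w eps j | s t i j. s \<in> signs \<and> t \<in> signs \<and> i \<in> {1..m} \<and> j \<in> {1..m} \<and> i \<noteq> j} \<union>
     {s *\<^sub>w eps i | s i. s \<in> signs \<and> i \<in> {1..m}} \<union>
     {s *\<^sub>w del k + t *\<^sub>w del l | s t k l. s \<in> signs \<and> t \<in> signs \<and> k \<in> {1..n} \<and> l \<in> {1..n} \<and> k \<noteq> l} \<union>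
     {(2 * s) *\<^sub>w del k | s k. s \<in> signs \<and> k \<in> {1..n}}"

definition odd_roots :: "nat \<Rightarrow> nat \<Rightarrow> weight set" where
  "odd_roots m n =
     {s *\<^sub>w eps i + t *\<^sub>w del k | s t i k. s \<in> signs \<and> t \<in> signs \<and> i \<in> {1..m} \<and> k \<in> {1..n}} \<union>
     {s *\<^sub>w del k | s k. s \<in> signs \<and> k \<in> {1..n}}"

definition roots :: "nat \<Rightarrow> nat \<Rightarrow> weight set" where
  "roots m n = even_roots m n \<union> odd_roots m n"

text \<open>The group of signed permutations of \<open>\<plusminus>\<epsilon>\<^sub>1, \<dots>, \<plusminus>\<epsilon>\<^sub>m\<close> and of
  \<open>\<plusminus>\<delta>\<^sub>1, \<dots>, \<plusminus>\<delta>\<^sub>n\<close>, acting on coordinates. In terms of the basis, the element written below maps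
  \<open>\<epsilon>\<^bsub>\<sigma> i\<^esub>\<close> to \<open>s i \<epsilon>\<^sub>i\<close> and \<open>\<delta>\<^bsub>\<tau> k\<^esub>\<close> to \<open>t k \<delta>\<^sub>k\<close>.\<close>

definition weyl_group :: "nat \<Rightarrow> nat \<Rightarrow> (weight \<Rightarrow> weight) set" where
  "weyl_group m n =
     {(\<lambda>\<alpha> x. case x of Eps i \<Rightarrow> s i * \<alpha> (Eps (\<sigma> i)) | Del k \<Rightarrow> t k * \<alpha> (Del (\<tau> k))) | \<sigma> \<tau> s t.
        \<sigma> permutes {1..m} \<and> \<tau> permutes {1..n} \<and>
        (\<forall>i. s i \<in> signs) \<and> (\<forall>i. i \<notin> {1..m} \<longrightarrow> s i = 1) \<and>
        (\<forall>k. t k \<in> signs) \<and> (\<forall>k. k \<notin> {1..n} \<longrightarrow> t k = 1)}"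

definition cartan :: "nat \<Rightarrow> nat \<Rightarrow> complex mat set" where
  "cartan m n = {H \<in> osp (2 * m + 1) (2 * n). diagonal_mat H}"

text \<open>A diagonal element \<open>H\<close> of \<open>osp(2m+1|2n)\<close> has the form
  \<open>diag(h\<^sub>1, \<dots>, h\<^sub>m, 0, -h\<^sub>m, \<dots>, -h\<^sub>1 | k\<^sub>1, \<dots>, k\<^sub>n, -k\<^sub>n, \<dots>, -k\<^sub>1)\<close>; then
  \<open>\<epsilon>\<^sub>i(H) = h\<^sub>i\<close> and \<open>\<delta>\<^sub>j(H) = k\<^sub>j\<close>. Matrix indices start at 0.\<close>

definition weight_eval :: "nat \<Rightarrow> nat \<Rightarrow> weight \<Rightarrow> complex mat \<Rightarrow> complex" where
  "weight_eval m n \<alpha> H =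
     (\<Sum>i = 1..m. of_int (\<alpha> (Eps i)) * H $$ (i - 1, i - 1)) +
     (\<Sum>k = 1..n. of_int (\<alpha> (Del k)) * H $$ (2 * m + k, 2 * m + k))"

definition root_space :: "nat \<Rightarrow> nat \<Rightarrow> weight \<Rightarrow> complex mat set" where
  "root_space m n \<alpha> = {X \<in> osp (2 * m + 1) (2 * n).
     \<forall>H\<in>cartan m n. superbracket (2 * m + 1) (2 * n) H X = weight_eval m n \<alpha> H \<cdot>\<^sub>m X}"

section \<open>Parabolic sets of roots\<close>

definition parabolic :: "nat \<Rightarrow> nat \<Rightarrow> weight set \<Rightarrow> bool" where
  "parabolic m n P \<longleftrightarrow>
     P \<subset> roots m n \<and>
     roots m n = P \<union> uminus ` P \<and>
     (\<forall>\<alpha>\<in>P. \<forall>\<beta>\<in>P. \<alpha> + \<beta> \<in> roots m n \<longrightarrow> \<alpha> + \<beta> \<in> P)"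

definition levi_roots :: "weight set \<Rightarrow> weight set" where
  "levi_roots P = P \<inter> uminus ` P"

definition nil_roots :: "weight set \<Rightarrow> weight set" where
  "nil_roots P = P - uminus ` P"

text \<open>Elementwise description of the sum of the root spaces \<open>g\<^sup>\<alpha>\<close>, \<open>\<alpha> \<in> S\<close>. Matrices of
  unspecified size do not form an additive monoid, so the finite sum is taken entrywise.\<close>

definition root_spaces_sum :: "nat \<Rightarrow> nat \<Rightarrow> weight set \<Rightarrow> complex mat set" where
  "root_spaces_sum m n S =
     {mat (2 * m + 1 + 2 * n) (2 * m + 1 + 2 * n) (\<lambda>ij. \<Sum>\<alpha>\<in>S. X \<alpha> $$ ij) | X.
        \<forall>\<alpha>\<in>S. X \<alpha> \<in> root_space m n \<alpha>}"

definition levi :: "nat \<Rightarrow> nat \<Rightarrow> weight set \<Rightarrow> complex mat set" where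
  "levi m n P = {H + X | H X. H \<in> cartan m n \<and> X \<in> root_spaces_sum m n (levi_roots P)}"

definition nilradical :: "nat \<Rightarrow> nat \<Rightarrow> weight set \<Rightarrow> complex mat set" where
  "nilradical m n P = root_spaces_sum m n (nil_roots P)"

definition cominuscule :: "nat \<Rightarrow> nat \<Rightarrow> weight set \<Rightarrow> bool" where
  "cominuscule m n P \<longleftrightarrow>
     (\<forall>X\<in>nilradical m n P. \<forall>Y\<in>nilradical m n P.
        superbracket (2 * m + 1) (2 * n) X Y = 0\<^sub>m (2 * m + 1 + 2 * n) (2 * m + 1 + 2 * n))"

definition P_osp_levi :: "nat \<Rightarrow> nat \<Rightarrow> weight set" where
  "P_osp_levi m n =
     {s *\<^sub>w eps i + t *\<^sub>w eps j | s t i j. s \<in> signs \<and> t \<in> signs \<and> i \<in> {2..m} \<and> j \<in> {2..m} \<and> i \<noteq> j} \<union>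
     {s *\<^sub>w eps i | s i. s \<in> signs \<and> i \<in> {2..m}} \<union>
     {s *\<^sub>w del k + t *\<^sub>w del l | s t k l. s \<in> signs \<and> t \<in> signs \<and> k \<in> {1..n} \<and> l \<in> {1..n} \<and> k \<noteq> l} \<union>
     {(2 * s) *\<^sub>w del k | s k. s \<in> signs \<and> k \<in> {1..n}} \<union>
     {s *\<^sub>w del k | s k. s \<in> signs \<and> k \<in> {1..n}} \<union>
     {s *\<^sub>w eps i + t *\<^sub>w del k | s t i k. s \<in> signs \<and> t \<in> signs \<and> i \<in> {2..m} \<and> k \<in> {1..n}}"

definition P_osp_nil :: "nat \<Rightarrow> nat \<Rightarrow> weight set" where
  "P_osp_nil m n =
     {eps 1 + t *\<^sub>w eps j | t j. t \<in> signs \<and> j \<in> {2..m}} \<union>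
     {eps 1} \<union>
     {eps 1 + t *\<^sub>w del k | t k. t \<in> signs \<and> k \<in> {1..n}}"

definition P_osp :: "nat \<Rightarrow> nat \<Rightarrow> weight set" where
  "P_osp m n = P_osp_levi m n \<union> P_osp_nil m n"

end

theory Submission
  imports Defs
begin

text \<open>Everything is read off from the weights of the standard representation \<open>V\<^bsup>2m+1|2n\<^esup>\<close>, which are
\<open>\<plusminus>\<epsilon>\<^sub>i\<close>, \<open>0\<close>, \<open>\<plusminus>\<delta>\<^sub>k\<close>. They are pairwise different, one for each matrix index, and the roots are
exactly the sums of two of them that are neither zero nor \<open>\<plusminus>2\<epsilon>\<^sub>i\<close> (\<open>root_pair_sum\<close>, \<open>roots_pairE\<close>);
in particular every nonzero weight is itself a root, called short below.

\<^bold>\<open>Classification.\<close> Let \<open>P\<close> be parabolic with abelian nilradical. For two short roots in \<open>N\<^sup>+\<close>,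
explicit root vectors have a nonzero bracket unless the two roots coincide and are even
(\<open>short_vectors_bracket\<close>). For \<open>\<plusminus>\<delta>\<^sub>k\<close> this applies to the root and itself, because the square of an odd
root vector survives; so all \<open>\<plusminus>\<delta>\<^sub>k\<close> lie in \<open>L\<close>, and \<open>N\<^sup>+\<close> contains at most one of the \<open>\<plusminus>\<epsilon>\<^sub>i\<close>. It
contains one, since otherwise \<open>L\<close> would contain all short roots and, being closed, all roots. Call
it \<open>\<gamma>\<close>, with matrix index \<open>c\<close>. All short roots other than \<open>\<plusminus>\<gamma>\<close> are in \<open>L\<close>, and from
\<open>L + L \<subseteq> L\<close>, \<open>N\<^sup>+ + L \<subseteq> N\<^sup>+\<close> (for sums that are roots) one reads off that \<open>P\<close> consists of the roots
on which the coordinate along \<open>\<gamma>\<close> is nonnegative (\<open>parabolic_eq_max\<close>). The signed transposition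
exchanging \<open>\<gamma>\<close> and \<open>\<epsilon>\<^sub>1\<close> moves \<open>P\<close> to the standard parabolic set.

\<^bold>\<open>Structure.\<close> Give the matrix index of \<open>\<gamma>\<close> degree 1, that of \<open>-\<gamma>\<close> degree \<open>-1\<close> and all others
degree 0. Then \<open>l\<close> and \<open>n\<^sup>+\<close> are the orthosymplectic matrices that are homogeneous of degree 0 and 1
(\<open>levi_max\<close>, \<open>nilradical_max\<close>). A matrix of degree 0 is block diagonal; it is determined by its
middle block, an arbitrary element of \<open>osp(2m-1|2n)\<close>, and by its entry at \<open>(c, c)\<close>, an
arbitrary scalar (\<open>levi_iso\<close>). A matrix of degree 1 is determined by its column at the index of
\<open>-\<gamma>\<close>, an arbitrary vector of \<open>V\<^bsup>2m-1|2n\<^esup>\<close>, on which \<open>l\<close> acts through the sum of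
the middle block and the scalar (\<open>nil_iso\<close>).\<close>

section \<open>Orthosymplectic matrices entry by entry\<close>

text \<open>The index paired with \<open>i\<close> by the form: its Gram matrix has in row \<open>i\<close> a single nonzero entry, in this
  column.\<close>

definition dual_index :: "nat \<Rightarrow> nat \<Rightarrow> nat \<Rightarrow> nat" where
  "dual_index p q i = (if i < p then p - 1 - i else 2 * p + q - 1 - i)"

text \<open>The nonzero entry of the Gram matrix in row \<open>i\<close>.\<close>

definition form_sign :: "nat \<Rightarrow> nat \<Rightarrow> nat \<Rightarrow> complex" where
  "form_sign p q i = (if i < p \<or> i < dual_index p q i then 1 else - 1)"

lemma dual_less [simp]: "i < p + q \<Longrightarrow> dual_index p q i < p + q"
  by (auto simp: dual_index_def)

lemma dual_dual [simp]: "i < p + q \<Longrightarrow> dual_index p q (dual_index p q i) = i"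
  by (auto simp: dual_index_def)

lemma idx_parity_dual [simp]: "i < p + q \<Longrightarrow> idx_parity p (dual_index p q i) = idx_parity p i"
  by (auto simp: dual_index_def idx_parity_def)

lemma dual_eq_iff: "i < p + q \<Longrightarrow> j < p + q \<Longrightarrow> dual_index p q i = dual_index p q j \<longleftrightarrow> i = j"
  by (metis dual_dual)

lemma bij_betw_dual: "bij_betw (dual_index p q) {0..<p + q} {0..<p + q}"
  by (rule bij_betwI[where g = "dual_index p q"]) auto

lemma sum_dual: "(\<Sum>i\<in>{0..<p + q}. f (dual_index p q i)) = (\<Sum>i\<in>{0..<p + q}. f i)"
  by (rule sum.reindex_bij_betw[OF bij_betw_dual])

lemma form_sign_square [simp]: "form_sign p q i * form_sign p q i = 1" "form_sign p q i * (form_sign p q i * x) = x"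
  by (auto simp: form_sign_def)

lemma form_sign_nonzero [simp]: "form_sign p q i \<noteq> 0"
  by (auto simp: form_sign_def)

text \<open>The form is symmetric on the even part and skew on the odd part. Evenness of \<open>q\<close> excludes an odd index that is dual
  to itself.\<close>

lemma form_sign_dual:
  assumes "even q" "i < p + q"
  shows "form_sign p q (dual_index p q i) = (- 1) ^ idx_parity p i * form_sign p q i"
proof (cases "i < p")
  case True
  then show ?thesis by (auto simp: form_sign_def idx_parity_def dual_index_def)
next
  case False
  obtain r where "q = 2 * r" using assms(1) by auto
  then have "2 * i \<noteq> 2 * p + q - 1" using False assms(2) by presburger
  then show ?thesis using False assms(2) by (auto simp: form_sign_def idx_parity_def dual_index_def)
qed

lemma form_mat_index:
  "i < p + q \<Longrightarrow> j < p + q \<Longrightarrow>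
   form_mat p q $$ (i, j) = (if j = dual_index p q i then form_sign p q i else 0)"
  by (auto simp: form_mat_def dual_index_def form_sign_def)

lemma mult_mat_vec_nth:
  "X \<in> carrier_mat N M \<Longrightarrow> v \<in> carrier_vec M \<Longrightarrow> i < N \<Longrightarrow>
   (X *\<^sub>v v) $ i = (\<Sum>j\<in>{0..<M}. X $$ (i, j) * v $ j)"
  by (auto simp: scalar_prod_def intro!: sum.cong)

lemma sform_eq:
  assumes "v \<in> carrier_vec (p + q)" "w \<in> carrier_vec (p + q)"
  shows "sform p q v w = (\<Sum>i\<in>{0..<p + q}. v $ i * form_sign p q i * w $ (dual_index p q i))"
proof -
  have J: "form_mat p q \<in> carrier_mat (p + q) (p + q)"
    by (simp add: form_mat_def)
  have "(form_mat p q *\<^sub>v w) $ i = form_sign p q i * w $ (dual_index p q i)" if "i < p + q" for i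
  proof -
    have "(form_mat p q *\<^sub>v w) $ i =
        (\<Sum>j\<in>{0..<p + q}. if j = dual_index p q i then form_sign p q i * w $ j else 0)"
      unfolding mult_mat_vec_nth[OF J assms(2) that]
      by (rule sum.cong) (auto simp: form_mat_index that)
    then show ?thesis by (simp add: that)
  qed
  then show ?thesis
    using J unfolding sform_def scalar_prod_def
    by (auto simp: mult.assoc intro!: sum.cong)
qed

text \<open>Collecting the coefficients of \<open>v\<^sub>j w\<^bsub>i*\<^esub>\<close> turns invariance of the form into linear conditions on
  pairs of entries of \<open>X\<close>. The factor \<open>c\<close> stands for the sign, which depends on the parities of
  \<open>X\<close> and \<open>v\<close>.\<close>

lemma sform_invariance_eq:
  assumes X: "X \<in> carrier_mat (p + q) (p + q)"
    and v: "v \<in> carrier_vec (p + q)" and w: "w \<in> carrier_vec (p + q)"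
  shows "sform p q (X *\<^sub>v v) w + c * sform p q v (X *\<^sub>v w) =
    (\<Sum>i\<in>{0..<p + q}. \<Sum>j\<in>{0..<p + q}. v $ j * w $ (dual_index p q i) *
      (form_sign p q i * X $$ (i, j) + c * form_sign p q j * X $$ (dual_index p q j, dual_index p q i)))"
proof -
  have "sform p q (X *\<^sub>v v) w =
      (\<Sum>i\<in>{0..<p + q}. (X *\<^sub>v v) $ i * form_sign p q i * w $ (dual_index p q i))"
    using X v w by (intro sform_eq) auto
  also have "\<dots> = (\<Sum>i\<in>{0..<p + q}. \<Sum>j\<in>{0..<p + q}.
      v $ j * w $ (dual_index p q i) * (form_sign p q i * X $$ (i, j)))"
    by (intro sum.cong refl)
      (simp add: mult_mat_vec_nth[OF X v] sum_distrib_right sum_distrib_left mult_ac del: index_mult_mat_vec)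
  finally have 1: "sform p q (X *\<^sub>v v) w = \<dots>" .
  have "sform p q v (X *\<^sub>v w) =
      (\<Sum>j\<in>{0..<p + q}. v $ j * form_sign p q j * (X *\<^sub>v w) $ (dual_index p q j))"
    using X v w by (intro sform_eq) auto
  also have "\<dots> = (\<Sum>j\<in>{0..<p + q}. \<Sum>i\<in>{0..<p + q}.
      v $ j * form_sign p q j * (X $$ (dual_index p q j, i) * w $ i))"
    by (intro sum.cong refl)
      (simp add: mult_mat_vec_nth[OF X w] sum_distrib_left del: index_mult_mat_vec)
  also have "\<dots> = (\<Sum>j\<in>{0..<p + q}. \<Sum>i\<in>{0..<p + q}.
      v $ j * form_sign p q j * (X $$ (dual_index p q j, dual_index p q i) * w $ (dual_index p q i)))"
    by (subst sum_dual[of "\<lambda>i. v $ j * form_sign p q j * (X $$ (dual_index p q j, i) * w $ i)" p q for j, symmetric])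
      (rule refl)
  also have "\<dots> = (\<Sum>i\<in>{0..<p + q}. \<Sum>j\<in>{0..<p + q}.
      v $ j * form_sign p q j * (X $$ (dual_index p q j, dual_index p q i) * w $ (dual_index p q i)))"
    by (rule sum.swap)
  finally have 2: "sform p q v (X *\<^sub>v w) = \<dots>" .
  show ?thesis
    unfolding 1 2 by (simp add: sum_distrib_left sum.distrib[symmetric] algebra_simps)
qed

text \<open>One direction evaluates the form on unit vectors; the parity of \<open>v\<close> becomes that of the column index
  \<open>j\<close>. In the other direction the coordinates of a homogeneous \<open>v\<close> vanish at all indices of the wrong
  parity.\<close>

lemma osp_part_iff:
  assumes "a \<in> {0, 1}"
  shows "X \<in> osp_part p q a \<longleftrightarrow> X \<in> gl_part p q a \<and>
    (\<forall>i<p + q. \<forall>j<p + q. form_sign p q i * X $$ (i, j) +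
      (- 1) ^ (a * idx_parity p j) * form_sign p q j * X $$ (dual_index p q j, dual_index p q i) = 0)"
    (is "_ \<longleftrightarrow> _ \<and> ?E")
proof (cases "X \<in> gl_part p q a")
  case gl: True
  then have X: "X \<in> carrier_mat (p + q) (p + q)"
    by (simp add: gl_part_def)
  show ?thesis
  proof (intro iffI conjI)
    assume osp: "X \<in> osp_part p q a"
    show ?E
    proof (intro allI impI)
      fix i j assume ij: "i < p + q" "j < p + q"
      let ?v = "unit_vec (p + q) j :: complex vec"
      let ?w = "unit_vec (p + q) (dual_index p q i) :: complex vec"
      let ?c = "(- 1) ^ (a * idx_parity p j) :: complex"
      have "?v \<in> vec_part p q (idx_parity p j)"
        by (auto simp: vec_part_def unit_vec_def)
      then have "sform p q (X *\<^sub>v ?v) ?w + ?c * sform p q ?v (X *\<^sub>v ?w) = 0"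
        using osp unfolding osp_part_def by (auto simp: idx_parity_def)
      then have "0 = (\<Sum>i'\<in>{0..<p + q}. \<Sum>j'\<in>{0..<p + q}. ?v $ j' * ?w $ (dual_index p q i') *
          (form_sign p q i' * X $$ (i', j') + ?c * form_sign p q j' * X $$ (dual_index p q j', dual_index p q i')))"
        by (subst (asm) sform_invariance_eq[OF X]) auto
      also have "\<dots> = (\<Sum>i'\<in>{0..<p + q}. \<Sum>j'\<in>{0..<p + q}. if i' = i then if j' = j then
          form_sign p q i' * X $$ (i', j') + ?c * form_sign p q j' * X $$ (dual_index p q j', dual_index p q i') else 0 else 0)"
        using ij by (intro sum.cong refl) (auto simp: dual_eq_iff)
      also have "\<dots> = (\<Sum>i'\<in>{0..<p + q}. if i' = i then \<Sum>j'\<in>{0..<p + q}. if j' = j then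
          form_sign p q i' * X $$ (i', j') + ?c * form_sign p q j' * X $$ (dual_index p q j', dual_index p q i') else 0 else 0)"
        by (intro sum.cong refl) simp
      also have "\<dots> = form_sign p q i * X $$ (i, j) + ?c * form_sign p q j * X $$ (dual_index p q j, dual_index p q i)"
        using ij by simp
      finally show "form_sign p q i * X $$ (i, j) + ?c * form_sign p q j * X $$ (dual_index p q j, dual_index p q i) = 0"
        by simp
    qed
  next
    assume E: "X \<in> gl_part p q a \<and> ?E"
    have "sform p q (X *\<^sub>v v) w + (- 1) ^ (a * b) * sform p q v (X *\<^sub>v w) = 0"
      if "b \<in> {0, 1}" "v \<in> vec_part p q b" "w \<in> carrier_vec (p + q)" for b v w
    proof -
      have v: "v \<in> carrier_vec (p + q)" using that by (simp add: vec_part_def)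
      have "v $ j * w $ (dual_index p q i) * (form_sign p q i * X $$ (i, j) +
          (- 1) ^ (a * b) * form_sign p q j * X $$ (dual_index p q j, dual_index p q i)) = 0"
        if "i < p + q" "j < p + q" for i j
        using E that \<open>v \<in> vec_part p q b\<close>
        by (cases "idx_parity p j = b") (auto simp: vec_part_def)
      then show ?thesis
        unfolding sform_invariance_eq[OF X v that(3)] by (intro sum.neutral ballI) auto
    qed
    then show "X \<in> osp_part p q a" using gl unfolding osp_part_def by blast
  qed (use gl in auto)
qed (auto simp: osp_part_def)

text \<open>The sign relating the entries at \<open>(i, j)\<close> and at \<open>(j*, i*)\<close>. Its first factor is
  \<open>(-1)\<^bsup>a|j|\<^esup>\<close> for \<open>a = |i| + |j|\<close>, the parity of the matrix unit at \<open>(i,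
  j)\<close>.\<close>

definition osp_twist :: "nat \<Rightarrow> nat \<Rightarrow> nat \<Rightarrow> nat \<Rightarrow> complex" where
  "osp_twist p q i j = (if i < p \<and> p \<le> j then - 1 else 1) * form_sign p q i * form_sign p q j"

lemma osp_twist_nonzero [simp]: "osp_twist p q i j \<noteq> 0"
  by (simp add: osp_twist_def)

text \<open>The sign in the condition for a homogeneous matrix of parity \<open>a\<close> depends on \<open>a\<close>, but an entry at
  \<open>(i, j)\<close> can only be nonzero for \<open>a = |i| + |j|\<close>. Replacing \<open>a\<close> by this value makes the
  conditions for the two homogeneous components one and the same linear condition on their sum.\<close>

lemma osp_iff:
  "X \<in> osp p q \<longleftrightarrow> X \<in> carrier_mat (p + q) (p + q) \<and>
    (\<forall>i<p + q. \<forall>j<p + q. X $$ (dual_index p q j, dual_index p q i) = - osp_twist p q i j * X $$ (i, j))"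
proof -
  have key: "form_sign p q i * x + (- 1) ^ (a * idx_parity p j) * form_sign p q j * y = 0 \<longleftrightarrow>
      y = - osp_twist p q i j * x"
    if "i < p + q" "j < p + q" "(idx_parity p i + idx_parity p j) mod 2 = a" for x y i j a
  proof -
    have solve: "v * x + u * y = 0 \<longleftrightarrow> y = - (u * v) * x" if "u * u = 1" for u v x y :: complex
    proof
      assume "v * x + u * y = 0"
      then have "u * (v * x) + (u * u) * y = 0" by (metis distrib_left mult.assoc mult_zero_right)
      then show "y = - (u * v) * x" using that by (simp add: add_eq_0_iff)
    next
      assume "y = - (u * v) * x"
      then have "v * x + u * y = v * x - (u * u) * (v * x)" by (simp add: algebra_simps)
      then show "v * x + u * y = 0" using that by simp
    qed
    \<comment> \<open>\<open>u\<close> is the sign in front of \<open>y\<close>; being its own inverse, it can be moved to the other side.\<close>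
    define u where "u = (- 1) ^ (a * idx_parity p j) * form_sign p q j"
    have "u * u = 1"
      by (auto simp: u_def form_sign_def power_mult_distrib[symmetric] simp flip: power_add)
    moreover have "u * form_sign p q i = osp_twist p q i j"
      using that(3) by (auto simp: u_def osp_twist_def idx_parity_def split: if_splits)
    ultimately show ?thesis using solve[of u "form_sign p q i" x y] unfolding u_def by simp
  qed
  have part: "X \<in> osp_part p q a \<longleftrightarrow> X \<in> gl_part p q a \<and> (\<forall>i<p + q. \<forall>j<p + q.
      X $$ (dual_index p q j, dual_index p q i) = - osp_twist p q i j * X $$ (i, j))"
    if "a \<in> {0, 1}" for X a
  proof -
    have "form_sign p q i * X $$ (i, j) +
      (- 1) ^ (a * idx_parity p j) * form_sign p q j * X $$ (dual_index p q j, dual_index p q i) = 0 \<longleftrightarrow>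
      X $$ (dual_index p q j, dual_index p q i) = - osp_twist p q i j * X $$ (i, j)"
      if "X \<in> gl_part p q a" "i < p + q" "j < p + q" for i j
    proof (cases "(idx_parity p i + idx_parity p j) mod 2 = a")
      case True
      then show ?thesis using key that by blast
    next
      case False
      then have "X $$ (i, j) = 0" "X $$ (dual_index p q j, dual_index p q i) = 0"
        using that by (auto simp: gl_part_def add.commute)
      then show ?thesis by simp
    qed
    then show ?thesis unfolding osp_part_iff[OF that] by blast
  qed
  show ?thesis
  proof (intro iffI conjI)
    assume "X \<in> osp p q"
    then obtain Y Z where X: "X = Y + Z" "Y \<in> osp_part p q 0" "Z \<in> osp_part p q 1"
      by (auto simp: osp_def)
    then have c: "Y \<in> carrier_mat (p + q) (p + q)" "Z \<in> carrier_mat (p + q) (p + q)"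
      by (auto simp: osp_part_def gl_part_def)
    show "X \<in> carrier_mat (p + q) (p + q)" using c X by simp
    show "\<forall>i<p + q. \<forall>j<p + q. X $$ (dual_index p q j, dual_index p q i) = - osp_twist p q i j * X $$ (i, j)"
      using c X by (auto simp: part algebra_simps)
  next
    assume R: "X \<in> carrier_mat (p + q) (p + q) \<and>
      (\<forall>i<p + q. \<forall>j<p + q. X $$ (dual_index p q j, dual_index p q i) = - osp_twist p q i j * X $$ (i, j))"
    have "homog_comp p q a X \<in> osp_part p q a" if "a \<in> {0, 1}" for a
      using R that unfolding part[OF that] by (auto simp: gl_part_def homog_comp_def add.commute)
    moreover have "X = homog_comp p q 0 X + homog_comp p q 1 X"
      using R by (auto simp: homog_comp_def mod2_eq_if)
    ultimately show "X \<in> osp p q"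
      unfolding osp_def by (metis (mono_tags, lifting) insertCI mem_Collect_eq)
  qed
qed

lemma osp_carrier: "X \<in> osp p q \<Longrightarrow> X \<in> carrier_mat (p + q) (p + q)"
  by (simp add: osp_iff)

lemma osp_nth: "X \<in> osp p q \<Longrightarrow> i < p + q \<Longrightarrow> j < p + q \<Longrightarrow>
    X $$ (dual_index p q j, dual_index p q i) = - osp_twist p q i j * X $$ (i, j)"
  by (simp add: osp_iff)

lemma osp_twist_square [simp]: "osp_twist p q i j * osp_twist p q i j = 1"
  "osp_twist p q i j * (osp_twist p q i j * x) = x"
  by (auto simp: osp_twist_def form_sign_def)

lemma osp_nth':
  assumes "X \<in> osp p q" "i < p + q" "j < p + q"
  shows "X $$ (i, j) = - osp_twist p q i j * X $$ (dual_index p q j, dual_index p q i)"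
  by (simp add: osp_nth[OF assms])

text \<open>The sign in the superbracket for exchanging the matrix units at \<open>(a, c)\<close> and \<open>(c, b)\<close>; it is
  \<open>-1\<close> exactly if both are odd.\<close>

definition swap_sign :: "nat \<Rightarrow> nat \<Rightarrow> nat \<Rightarrow> nat \<Rightarrow> complex" where
  "swap_sign p a c b = (if idx_parity p a \<noteq> idx_parity p c \<and> idx_parity p c \<noteq> idx_parity p b then - 1 else 1)"

lemma mat_mult_nth:
  "X \<in> carrier_mat N N \<Longrightarrow> Y \<in> carrier_mat N N \<Longrightarrow> a < N \<Longrightarrow> b < N \<Longrightarrow>
   (X * Y) $$ (a, b) = (\<Sum>c\<in>{0..<N}. X $$ (a, c) * Y $$ (c, b))"
  by (auto simp: scalar_prod_def intro!: sum.cong)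

lemma superbracket_carrier [simp]:
  "X \<in> carrier_mat (p + q) (p + q) \<Longrightarrow> Y \<in> carrier_mat (p + q) (p + q) \<Longrightarrow>
   superbracket p q X Y \<in> carrier_mat (p + q) (p + q)"
  by (auto simp: superbracket_def Let_def homog_comp_def)

lemma superbracket_nth:
  assumes X: "X \<in> carrier_mat (p + q) (p + q)" and Y: "Y \<in> carrier_mat (p + q) (p + q)"
    and ab: "a < p + q" "b < p + q"
  shows "superbracket p q X Y $$ (a, b) = (\<Sum>c\<in>{0..<p + q}.
    X $$ (a, c) * Y $$ (c, b) - swap_sign p a c b * Y $$ (a, c) * X $$ (c, b))"
proof -
  have H: "homog_comp p q d Z \<in> carrier_mat (p + q) (p + q)" for d Z
    by (simp add: homog_comp_def)
  let ?X = "\<lambda>d. homog_comp p q d X" and ?Y = "\<lambda>d. homog_comp p q d Y"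
  have "(?Y 0 * ?X 0 + ?Y 0 * ?X 1 + ?Y 1 * ?X 0 - ?Y 1 * ?X 1) $$ (a, b) =
      (\<Sum>c\<in>{0..<p + q}. ?Y 0 $$ (a, c) * ?X 0 $$ (c, b) + ?Y 0 $$ (a, c) * ?X 1 $$ (c, b)
        + ?Y 1 $$ (a, c) * ?X 0 $$ (c, b) - ?Y 1 $$ (a, c) * ?X 1 $$ (c, b))"
    using H[of 0 X] H[of 1 X] H[of 0 Y] H[of 1 Y] ab
    by (simp add: mat_mult_nth[OF H H] sum.distrib sum_subtractf del: index_mult_mat(1))
  also have "\<dots> = (\<Sum>c\<in>{0..<p + q}. swap_sign p a c b * Y $$ (a, c) * X $$ (c, b))"
    using ab by (intro sum.cong refl)
      (auto simp: homog_comp_def swap_sign_def idx_parity_def)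
  finally show ?thesis
    using H[of 0 X] H[of 1 X] H[of 0 Y] H[of 1 Y] X Y ab unfolding superbracket_def Let_def
    by (subst index_minus_mat) (auto simp: mat_mult_nth[OF X Y] sum_subtractf simp del: index_mult_mat(1))
qed

section \<open>Roots as sums of two weights of the standard representation\<close>

text \<open>The weight of the Cartan subalgebra on the basis vector with index \<open>a\<close> of the standard representation. In the order
  of the basis these are \<open>\<epsilon>\<^sub>1, \<dots>, \<epsilon>\<^sub>m, 0, -\<epsilon>\<^sub>m, \<dots>,
  -\<epsilon>\<^sub>1 | \<delta>\<^sub>1, \<dots>, \<delta>\<^sub>n, -\<delta>\<^sub>n, \<dots>, -\<delta>\<^sub>1\<close>.\<close>

definition index_weight :: "nat \<Rightarrow> nat \<Rightarrow> nat \<Rightarrow> nat \<Rightarrow> nat \<Rightarrow> weight" where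
  "index_weight m n p q a =
    (if a < m then eps (a + 1) else if a = m then 0 else if a < p then - eps (p - a)
     else if a < p + n then del (a + 1 - p) else - del (p + q - a))"

text \<open>The matrix indices with weight \<open>s \<epsilon>\<^sub>i\<close> and \<open>s \<delta>\<^sub>k\<close>, for a sign
  \<open>s\<close>.\<close>

definition eps_index :: "nat \<Rightarrow> int \<Rightarrow> nat \<Rightarrow> nat" where
  "eps_index p s i = (if s = 1 then i - 1 else p - i)"

definition del_index :: "nat \<Rightarrow> nat \<Rightarrow> int \<Rightarrow> nat \<Rightarrow> nat" where
  "del_index p q s k = (if s = 1 then p + k - 1 else p + q - k)"

text \<open>The coordinate of \<open>\<alpha>\<close> along the weight \<open>\<plusminus>\<epsilon>\<^sub>i\<close> of the even index
  \<open>c\<close>.\<close>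

definition coord_level :: "nat \<Rightarrow> nat \<Rightarrow> nat \<Rightarrow> weight \<Rightarrow> int" where
  "coord_level m p c \<alpha> = (if c < m then \<alpha> (Eps (c + 1)) else - \<alpha> (Eps (p - c)))"

lemma index_weight_Eps:
  "index_weight m n p q a (Eps i) = (if a < m then if i = a + 1 then 1 else 0
    else if m < a \<and> a < p then if i = p - a then - 1 else 0 else 0)"
  by (auto simp: index_weight_def eps_def del_def)

locale odd_orthosymplectic =
  fixes m n p q :: nat
  assumes p_eq: "p = 2 * m + 1" and q_eq: "q = 2 * n"
begin

abbreviation dl :: "nat \<Rightarrow> nat" where
  "dl \<equiv> dual_index p q"

abbreviation wt :: "nat \<Rightarrow> weight" where
  "wt \<equiv> index_weight m n p q"

abbreviation level :: "nat \<Rightarrow> weight \<Rightarrow> int" where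
  "level \<equiv> coord_level m p"

abbreviation eps_idx :: "int \<Rightarrow> nat \<Rightarrow> nat" where
  "eps_idx \<equiv> eps_index p"

abbreviation del_idx :: "int \<Rightarrow> nat \<Rightarrow> nat" where
  "del_idx \<equiv> del_index p q"

lemma m_less: "m < p" "m < p + q"
  using p_eq by auto

lemma dl_zero [simp]: "dl m = m"
  using p_eq by (auto simp: dual_index_def)

lemma dl_eq_self_iff: "a < p + q \<Longrightarrow> dl a = a \<longleftrightarrow> a = m"
  using p_eq q_eq by (auto simp: dual_index_def) presburger+

lemma dl_eq_zero_iff [simp]: "a < p + q \<Longrightarrow> dl a = m \<longleftrightarrow> a = m"
  using dual_eq_iff[of a p q m] m_less by simp

lemma dl_even_iff: "a < p + q \<Longrightarrow> dl a < p \<longleftrightarrow> a < p"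
  by (auto simp: dual_index_def)

lemma wt_zero [simp]: "wt m = 0"
  by (simp add: index_weight_def)

lemma index_ranges:
  assumes "a < p + q"
  obtains "a < m" "m < dl a" "dl a < p" "p - dl a = a + 1"
    | "a = m"
    | "m < a" "a < p" "dl a < m" "p - a = dl a + 1"
    | "p \<le> a" "a < p + n" "p + n \<le> dl a" "p + q - dl a = a + 1 - p"
    | "p + n \<le> a" "p \<le> dl a" "dl a < p + n" "p + q - a = dl a + 1 - p"
proof -
  consider "a < m" | "a = m" | "m < a" "a < p" | "p \<le> a" "a < p + n" | "p + n \<le> a"
    by linarith
  then show ?thesis
    by cases (rule that; use assms p_eq q_eq in \<open>auto simp: dual_index_def\<close>)+
qed

lemma wt_dual:
  assumes "a < p + q"
  shows "wt (dl a) = - wt a"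
  using assms m_less by (cases rule: index_ranges) (auto simp: index_weight_def)

lemma eps_idx:
  assumes "s \<in> signs" "i \<in> {1..m}"
  shows "wt (eps_idx s i) = s *\<^sub>w eps i" "eps_idx s i < p" "eps_idx s i < p + q" "eps_idx s i \<noteq> m"
    "dl (eps_idx s i) = eps_idx (- s) i"
  using assms p_eq by (auto simp: eps_index_def index_weight_def wscale_def dual_index_def fun_eq_iff)

lemma del_idx:
  assumes "s \<in> signs" "k \<in> {1..n}"
  shows "wt (del_idx s k) = s *\<^sub>w del k" "p \<le> del_idx s k" "del_idx s k < p + q" "del_idx s k \<noteq> m"
    "dl (del_idx s k) = del_idx (- s) k"
  using assms p_eq q_eq by (auto simp: del_index_def index_weight_def wscale_def dual_index_def fun_eq_iff)

lemma eps_idx_inj: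
  assumes "s \<in> signs" "i \<in> {1..m}" "t \<in> signs" "j \<in> {1..m}"
  shows "eps_idx s i = eps_idx t j \<longleftrightarrow> s = t \<and> i = j"
  using assms p_eq by (auto simp: eps_index_def)

lemma del_idx_inj:
  assumes "s \<in> signs" "i \<in> {1..n}" "t \<in> signs" "j \<in> {1..n}"
  shows "del_idx s i = del_idx t j \<longleftrightarrow> s = t \<and> i = j"
  using assms p_eq q_eq by (auto simp: del_index_def)

lemma index_cases:
  assumes "a < p + q"
  obtains "a = m" | s i where "s \<in> signs" "i \<in> {1..m}" "a = eps_idx s i"
    | s k where "s \<in> signs" "k \<in> {1..n}" "a = del_idx s k"
proof -
  consider "a < m" | "a = m" | "m < a" "a < p" | "p \<le> a" "a < p + n" | "p + n \<le> a"
    by linarith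
  then show ?thesis
  proof cases
    case 1
    then show ?thesis by (intro that(2)[of 1 "a + 1"]) (auto simp: eps_index_def)
  next
    case 2
    then show ?thesis by (rule that(1))
  next
    case 3
    then show ?thesis using p_eq by (intro that(2)[of "- 1" "p - a"]) (auto simp: eps_index_def)
  next
    case 4
    then show ?thesis by (intro that(3)[of 1 "a + 1 - p"]) (auto simp: del_index_def)
  next
    case 5
    then show ?thesis using assms q_eq by (intro that(3)[of "- 1" "p + q - a"]) (auto simp: del_index_def)
  qed
qed

lemma roots_cases:
  assumes "\<alpha> \<in> roots m n"
  obtains s t i j where "s \<in> signs" "t \<in> signs" "i \<in> {1..m}" "j \<in> {1..m}" "i \<noteq> j"
      "\<alpha> = s *\<^sub>w eps i + t *\<^sub>w eps j"
    | s i where "s \<in> signs" "i \<in> {1..m}" "\<alpha> = s *\<^sub>w eps i"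
    | s t k l where "s \<in> signs" "t \<in> signs" "k \<in> {1..n}" "l \<in> {1..n}" "k \<noteq> l"
      "\<alpha> = s *\<^sub>w del k + t *\<^sub>w del l"
    | s k where "s \<in> signs" "k \<in> {1..n}" "\<alpha> = (2 * s) *\<^sub>w del k"
    | s t i k where "s \<in> signs" "t \<in> signs" "i \<in> {1..m}" "k \<in> {1..n}"
      "\<alpha> = s *\<^sub>w eps i + t *\<^sub>w del k"
    | s k where "s \<in> signs" "k \<in> {1..n}" "\<alpha> = s *\<^sub>w del k"
  using assms unfolding roots_def even_roots_def odd_roots_def
  apply (elim UnE CollectE exE conjE)
  apply (rule that(1); assumption)
  apply (rule that(2); assumption)
  apply (rule that(3); assumption)
  apply (rule that(4); assumption)
  apply (rule that(5); assumption)
  apply (rule that(6); assumption)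
  done

lemma rootsI:
  "s \<in> signs \<Longrightarrow> t \<in> signs \<Longrightarrow> i \<in> {1..m} \<Longrightarrow> j \<in> {1..m} \<Longrightarrow> i \<noteq> j \<Longrightarrow>
    s *\<^sub>w eps i + t *\<^sub>w eps j \<in> roots m n"
  "s \<in> signs \<Longrightarrow> i \<in> {1..m} \<Longrightarrow> s *\<^sub>w eps i \<in> roots m n"
  "s \<in> signs \<Longrightarrow> t \<in> signs \<Longrightarrow> k \<in> {1..n} \<Longrightarrow> l \<in> {1..n} \<Longrightarrow> k \<noteq> l \<Longrightarrow>
    s *\<^sub>w del k + t *\<^sub>w del l \<in> roots m n"
  "s \<in> signs \<Longrightarrow> k \<in> {1..n} \<Longrightarrow> (2 * s) *\<^sub>w del k \<in> roots m n"
  "s \<in> signs \<Longrightarrow> t \<in> signs \<Longrightarrow> i \<in> {1..m} \<Longrightarrow> k \<in> {1..n} \<Longrightarrow>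
    s *\<^sub>w eps i + t *\<^sub>w del k \<in> roots m n"
  "s \<in> signs \<Longrightarrow> k \<in> {1..n} \<Longrightarrow> s *\<^sub>w del k \<in> roots m n"
  unfolding roots_def even_roots_def odd_roots_def by blast+

text \<open>Since the adjoint representation is the super exterior square of the standard one, its weights are the sums of two weights of the
  latter, where an even weight may not be repeated. Leaving out the sums equal to zero, that is, the pairs of dual indices, gives
  the roots.\<close>

definition root_pair :: "nat \<Rightarrow> nat \<Rightarrow> bool" where
  "root_pair a b \<longleftrightarrow> a < p + q \<and> b < p + q \<and> a \<noteq> dl b \<and> \<not> (a = b \<and> a < p)"

lemma root_pair_sum:
  assumes "root_pair a b"
  shows "wt a + wt b \<in> roots m n"
proof -
  have ab: "a < p + q" "b < p + q" "a \<noteq> dl b" "\<not> (a = b \<and> a < p)"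
    using assms by (auto simp: root_pair_def)
  show ?thesis
    using ab(1)
  proof (cases rule: index_cases)
    case a: 1
    show ?thesis using ab(2)
    proof (cases rule: index_cases)
      case 1
      then show ?thesis using a ab by auto
    next
      case (2 s i)
      then show ?thesis using a by (simp add: eps_idx(1) rootsI(2) del: insert_iff atLeastAtMost_iff)
    next
      case (3 s k)
      then show ?thesis using a by (simp add: del_idx(1) rootsI(6) del: insert_iff atLeastAtMost_iff)
    qed
  next
    case a: (2 s i)
    show ?thesis using ab(2)
    proof (cases rule: index_cases)
      case 1
      then show ?thesis using a by (simp add: eps_idx(1) rootsI(2) del: insert_iff atLeastAtMost_iff)
    next
      case (2 t j)
      have "i \<noteq> j"
      proof
        assume "i = j"
        then have "s = t \<or> s = - t" using a 2 by auto
        then show False using \<open>i = j\<close> ab a 2 by (auto simp: eps_idx(2,5))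
      qed
      then show ?thesis using a 2 by (simp add: eps_idx(1) rootsI(1) del: insert_iff atLeastAtMost_iff)
    next
      case (3 t k)
      then show ?thesis using a
        by (simp add: eps_idx(1) del_idx(1) rootsI(5) del: insert_iff atLeastAtMost_iff)
    qed
  next
    case a: (3 s k)
    show ?thesis using ab(2)
    proof (cases rule: index_cases)
      case 1
      then show ?thesis using a by (simp add: del_idx(1) rootsI(6) del: insert_iff atLeastAtMost_iff)
    next
      case (2 t i)
      then show ?thesis using a rootsI(5)[of t s i k]
        by (simp add: eps_idx(1) del_idx(1) add.commute del: insert_iff atLeastAtMost_iff)
    next
      case (3 t l)
      show ?thesis
      proof (cases "k = l")
        case True
        then have "s \<noteq> - t" using ab a 3 by (auto simp: del_idx(5))
        then have "s = t" using a 3 by auto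
        then have "wt a + wt b = (2 * s) *\<^sub>w del k"
          using a 3 True by (simp add: del_idx(1) wscale_def fun_eq_iff del: insert_iff atLeastAtMost_iff)
        then show ?thesis using a rootsI(4) by simp
      next
        case False
        then show ?thesis using a 3 by (simp add: del_idx(1) rootsI(3) del: insert_iff atLeastAtMost_iff)
      qed
    qed
  qed
qed

lemma roots_pairE:
  assumes "\<alpha> \<in> roots m n"
  obtains a b where "root_pair a b" "\<alpha> = wt a + wt b"
  using assms
proof (cases rule: roots_cases)
  case (1 s t i j)
  then have "root_pair (eps_idx s i) (eps_idx t j)"
    using eps_idx(3,5)[of s i] eps_idx(3,5)[of t j] eps_idx_inj[of s i t j] eps_idx_inj[of s i "- t" j]
    by (auto simp: root_pair_def)
  then show ?thesis using that 1 by (metis eps_idx(1))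
next
  case (2 s i)
  then have "root_pair (eps_idx s i) m"
    using eps_idx(2,3,4)[of s i] m_less by (auto simp: root_pair_def)
  then show ?thesis using that 2 by (metis eps_idx(1) wt_zero add.right_neutral)
next
  case (3 s t k l)
  then have "root_pair (del_idx s k) (del_idx t l)"
    using del_idx(2,3,5)[of s k] del_idx(3,5)[of t l] del_idx_inj[of s k t l] del_idx_inj[of s k "- t" l]
    by (auto simp: root_pair_def)
  then show ?thesis using that 3 by (metis del_idx(1))
next
  case (4 s k)
  then have "root_pair (del_idx s k) (del_idx s k)"
    using del_idx(2,3,5)[of s k] del_idx_inj[of s k "- s" k]
    by (auto simp: root_pair_def)
  moreover have "\<alpha> = wt (del_idx s k) + wt (del_idx s k)"
    using 4 by (simp add: del_idx(1) wscale_def fun_eq_iff del: insert_iff atLeastAtMost_iff)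
  ultimately show ?thesis using that by blast
next
  case (5 s t i k)
  then have "root_pair (eps_idx s i) (del_idx t k)"
    using eps_idx(2,3)[of s i] del_idx(2,3)[of t k] del_idx(2)[of "- t" k] del_idx(5)[of t k]
    by (auto simp: root_pair_def)
  then show ?thesis using that 5 by (metis del_idx(1) eps_idx(1))
next
  case (6 s k)
  then have "root_pair (del_idx s k) m"
    using del_idx(2,3,4)[of s k] m_less by (auto simp: root_pair_def)
  then show ?thesis using that 6 by (metis del_idx(1) wt_zero add.right_neutral)
qed

lemma root_pair_dual: "root_pair a b \<Longrightarrow> root_pair (dl a) (dl b)"
  unfolding root_pair_def by (metis dl_even_iff dual_dual dual_less)

lemma root_pair_commute: "root_pair a b \<Longrightarrow> root_pair b a"
  unfolding root_pair_def by (metis dual_dual)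

lemma uminus_root: "\<alpha> \<in> roots m n \<Longrightarrow> - \<alpha> \<in> roots m n"
  by (elim roots_pairE)
    (metis root_pair_dual root_pair_sum wt_dual root_pair_def minus_add_distrib)

lemma wt_root: "a < p + q \<Longrightarrow> a \<noteq> m \<Longrightarrow> wt a \<in> roots m n"
  using root_pair_sum[of a m] m_less by (auto simp: root_pair_def)

lemma finite_roots: "finite (roots m n)"
proof -
  have "roots m n \<subseteq> (\<lambda>(a, b). wt a + wt b) ` ({..<p + q} \<times> {..<p + q})"
    by (auto simp: root_pair_def elim!: roots_pairE)
  then show ?thesis by (rule finite_subset) auto
qed

lemma level_add: "level c (\<alpha> + \<beta>) = level c \<alpha> + level c \<beta>"
  and level_uminus: "level c (- \<alpha>) = - level c \<alpha>"
  and level_diff: "level c (\<alpha> - \<beta>) = level c \<alpha> - level c \<beta>"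
  and level_zero: "level c 0 = 0"
  by (auto simp: coord_level_def)

lemma level_wt:
  assumes "c < p" "c \<noteq> m" "a < p + q"
  shows "level c (wt a) = (if a = c then 1 else if a = dl c then - 1 else 0)"
proof -
  have c: "c < p + q" using assms by simp
  show ?thesis
    using c
  proof (cases rule: index_ranges)
    case 1
    then have "c + 1 = p - a \<longleftrightarrow> a = dl c" if "a < p" using that by linarith
    then show ?thesis using 1 assms(3) by (auto simp: coord_level_def index_weight_Eps)
  next
    case 3
    then have "p - c = p - a \<longleftrightarrow> a = c" if "a < p" using that by linarith
    then show ?thesis using 3 assms(3) by (auto simp: coord_level_def index_weight_Eps)
  qed (use assms in auto)
qed

text \<open>The maximal parabolic set belonging to the stabiliser of the isotropic line spanned by the basis vector with index
  \<open>c\<close>.\<close>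

definition max_parabolic :: "nat \<Rightarrow> weight set" where
  "max_parabolic c = {\<alpha> \<in> roots m n. 0 \<le> level c \<alpha>}"

text \<open>The value 2 would need the sum of the weight of \<open>c\<close> with itself, which is not a root because \<open>c\<close> is
  even.\<close>

lemma level_root:
  assumes "c < p" "c \<noteq> m" "\<alpha> \<in> roots m n"
  shows "level c \<alpha> \<in> {- 1, 0, 1}"
proof -
  obtain a b where ab: "root_pair a b" "\<alpha> = wt a + wt b"
    using assms(3) by (rule roots_pairE)
  have "dl c < p" using assms by (simp add: dl_even_iff)
  then show ?thesis
    using ab assms by (auto simp: level_add level_wt root_pair_def)
qed

lemma levi_roots_max: "levi_roots (max_parabolic c) = {\<alpha> \<in> roots m n. level c \<alpha> = 0}"
  unfolding levi_roots_def max_parabolic_def image_def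
  using uminus_root by (auto simp: level_uminus) (metis level_uminus minus_minus neg_equal_0_iff_equal order_refl)

lemma nil_roots_max:
  assumes "c < p" "c \<noteq> m"
  shows "nil_roots (max_parabolic c) = {\<alpha> \<in> roots m n. level c \<alpha> = 1}"
proof (intro subset_antisym subsetI)
  fix \<alpha> assume "\<alpha> \<in> nil_roots (max_parabolic c)"
  then have a: "\<alpha> \<in> roots m n" "0 \<le> level c \<alpha>" "\<alpha> \<notin> uminus ` max_parabolic c"
    by (auto simp: nil_roots_def max_parabolic_def)
  have "- \<alpha> \<notin> max_parabolic c" using a(3) by (metis image_eqI minus_minus)
  then have "level c \<alpha> \<noteq> 0" using a(1) uminus_root by (auto simp: max_parabolic_def level_uminus)
  then show "\<alpha> \<in> {\<alpha> \<in> roots m n. level c \<alpha> = 1}" using a level_root[OF assms, of \<alpha>] by auto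
qed (auto simp: nil_roots_def max_parabolic_def level_uminus)

lemma parabolic_max:
  assumes c: "c < p" "c \<noteq> m"
  shows "parabolic m n (max_parabolic c)"
proof -
  have "dl c < p + q" "dl c \<noteq> m" "dl c \<noteq> c"
    using c dl_eq_self_iff[of c] by auto
  then have "wt (dl c) \<in> roots m n" "level c (wt (dl c)) < 0"
    using c by (auto simp: wt_root level_wt)
  then have out: "wt (dl c) \<in> roots m n" "wt (dl c) \<notin> max_parabolic c" by (auto simp: max_parabolic_def)
  have sub: "max_parabolic c \<subseteq> roots m n" by (auto simp: max_parabolic_def)
  have un: "roots m n = max_parabolic c \<union> uminus ` max_parabolic c"
  proof (intro subset_antisym subsetI)
    fix \<alpha> assume a: "\<alpha> \<in> roots m n"
    show "\<alpha> \<in> max_parabolic c \<union> uminus ` max_parabolic c"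
    proof (cases "0 \<le> level c \<alpha>")
      case True
      then show ?thesis using a by (simp add: max_parabolic_def)
    next
      case False
      then have "- \<alpha> \<in> max_parabolic c"
        using uminus_root[OF a] by (simp add: max_parabolic_def level_uminus)
      then show ?thesis by (metis UnI2 image_eqI minus_minus)
    qed
  next
    fix \<alpha> assume "\<alpha> \<in> max_parabolic c \<union> uminus ` max_parabolic c"
    then show "\<alpha> \<in> roots m n" using sub uminus_root by auto
  qed
  have cl: "\<alpha> + \<beta> \<in> max_parabolic c"
    if "\<alpha> \<in> max_parabolic c" "\<beta> \<in> max_parabolic c" "\<alpha> + \<beta> \<in> roots m n" for \<alpha> \<beta>
    using that by (simp add: max_parabolic_def level_add)
  show ?thesis
    unfolding parabolic_def using out sub un cl by (intro conjI psubsetI ballI impI) metis+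
qed

text \<open>The hypothesis on short roots is what commutativity of the nilradical provides. It forces exactly one short root \<open>wt
  c\<close> into \<open>N\<^sup>+\<close>, and since every root is a sum of two weights, the position of the short roots relative
  to \<open>P\<close> determines \<open>P\<close>.\<close>

lemma parabolic_eq_max:
  assumes par: "parabolic m n P"
    and ab: "\<And>a b. a < p + q \<Longrightarrow> b < p + q \<Longrightarrow> wt a \<in> nil_roots P \<Longrightarrow> wt b \<in> nil_roots P \<Longrightarrow> a = b \<and> a < p"
  shows "\<exists>c<p. c \<noteq> m \<and> P = max_parabolic c"
proof -
  have sub: "P \<subset> roots m n" and un: "\<And>\<alpha>. \<alpha> \<in> roots m n \<Longrightarrow> \<alpha> \<in> P \<or> - \<alpha> \<in> P"
    and cl: "\<And>\<alpha> \<beta>. \<alpha> \<in> P \<Longrightarrow> \<beta> \<in> P \<Longrightarrow> \<alpha> + \<beta> \<in> roots m n \<Longrightarrow> \<alpha> + \<beta> \<in> P"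
    using par unfolding parabolic_def by auto
  have im: "\<alpha> \<in> uminus ` P \<longleftrightarrow> - \<alpha> \<in> P" for \<alpha>
    by (metis image_iff minus_minus)
  let ?L = "levi_roots P" and ?N = "nil_roots P"
  have L: "\<alpha> \<in> ?L \<longleftrightarrow> \<alpha> \<in> P \<and> - \<alpha> \<in> P" and N: "\<alpha> \<in> ?N \<longleftrightarrow> \<alpha> \<in> P \<and> - \<alpha> \<notin> P" for \<alpha>
    by (auto simp: levi_roots_def nil_roots_def im)
  have LL: "\<alpha> + \<beta> \<in> ?L" if "\<alpha> \<in> ?L" "\<beta> \<in> ?L" "\<alpha> + \<beta> \<in> roots m n" for \<alpha> \<beta>
    using that cl[of \<alpha> \<beta>] cl[of "- \<alpha>" "- \<beta>"] uminus_root[of "\<alpha> + \<beta>"] by (auto simp: L)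
  \<comment> \<open>If the negative of the sum were in \<open>P\<close>, adding \<open>\<beta>\<close> would put \<open>- \<alpha>\<close> into \<open>P\<close>.\<close>
  have NL: "\<alpha> + \<beta> \<in> ?N" if "\<alpha> \<in> ?N" "\<beta> \<in> ?L" "\<alpha> + \<beta> \<in> roots m n" for \<alpha> \<beta>
  proof -
    have "\<alpha> + \<beta> \<in> P" using that cl by (auto simp: L N)
    moreover have False if "- (\<alpha> + \<beta>) \<in> P"
    proof -
      have "- \<alpha> \<in> roots m n" using \<open>\<alpha> \<in> ?N\<close> sub by (auto simp: N intro!: uminus_root)
      then have "- \<alpha> \<in> P" using cl[OF that, of \<beta>] \<open>\<beta> \<in> ?L\<close> by (auto simp: L)
      then show False using \<open>\<alpha> \<in> ?N\<close> by (auto simp: N)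
    qed
    ultimately show ?thesis by (auto simp: N)
  qed
  have short: "wt a \<in> ?L \<or> wt a \<in> ?N \<or> wt (dl a) \<in> ?N" if "a < p + q" "a \<noteq> m" for a
    using un[OF wt_root[OF that]] by (auto simp: L N wt_dual that)
  \<comment> \<open>An odd short root cannot be in \<open>N\<^sup>+\<close>, not even together with itself.\<close>
  have odd: "wt a \<in> ?L" if "a < p + q" "p \<le> a" for a
    using short[of a] ab[of a a] ab[of "dl a" "dl a"] that m_less dl_even_iff[of a] by auto
  have "\<exists>c<p. c \<noteq> m \<and> wt c \<in> ?N"
  proof (rule ccontr)
    assume no: "\<not> ?thesis"
    have all: "wt a \<in> ?L" if "a < p + q" "a \<noteq> m" for a
    proof (cases "a < p")
      case True
      then have "dl a < p" "dl a \<noteq> m" using that dl_even_iff[of a] by auto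
      then show ?thesis using short[OF that] no True that by blast
    qed (use odd that in auto)
    have "\<alpha> \<in> ?L" if r: "\<alpha> \<in> roots m n" for \<alpha>
    proof -
      obtain a b where "root_pair a b" "\<alpha> = wt a + wt b" using r by (rule roots_pairE)
      then show ?thesis
        using all[of a] all[of b] LL[of "wt a" "wt b"] r
        by (cases "a = m"; cases "b = m") (auto simp: root_pair_def)
    qed
    then show False using sub by (auto simp: L)
  qed
  then obtain c where c: "c < p" "c \<noteq> m" "wt c \<in> ?N" by blast
  have other: "wt a \<in> ?L" if "a < p + q" "a \<noteq> m" "a \<noteq> c" "a \<noteq> dl c" for a
    using short[of a] ab[of a c] ab[of "dl a" c] that c dual_dual[of a p q] by auto
  have pos: "\<alpha> \<in> ?N" if r: "\<alpha> \<in> roots m n" and "level c \<alpha> > 0" for \<alpha>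
  proof -
    obtain a b where rp: "root_pair a b" "\<alpha> = wt a + wt b" using r by (rule roots_pairE)
    then have "a = c \<or> b = c"
      using that(2) c by (auto simp: level_add level_wt root_pair_def split: if_splits)
    then obtain b' where b': "root_pair c b'" "\<alpha> = wt c + wt b'"
      using rp root_pair_commute by (metis add.commute)
    then have "b' \<noteq> dl c"
      using c by (metis dual_dual root_pair_def)
    then have "b' = m \<or> wt b' \<in> ?L"
      using b'(1) other[of b'] c by (auto simp: root_pair_def)
    then show ?thesis using b' c(3) NL that(1) by auto
  qed
  have zero: "\<alpha> \<in> ?L" if r: "\<alpha> \<in> roots m n" and "level c \<alpha> = 0" for \<alpha>
  proof -
    obtain a b where rp: "root_pair a b" "\<alpha> = wt a + wt b" using r by (rule roots_pairE)
    then have "a \<notin> {c, dl c}" "b \<notin> {c, dl c}" and r: "a < p + q" "b < p + q" "a \<noteq> dl b"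
      using that(2) c by (auto simp: level_add level_wt root_pair_def split: if_splits)
    then have "a = m \<or> wt a \<in> ?L" "b = m \<or> wt b \<in> ?L"
      using other[of a] other[of b] by auto
    then show ?thesis using rp(2) LL[of "wt a" "wt b"] that(1) r by auto
  qed
  have "\<alpha> \<in> P \<longleftrightarrow> \<alpha> \<in> max_parabolic c" for \<alpha>
  proof (cases "\<alpha> \<in> roots m n")
    case True
    then show ?thesis
      using zero[of \<alpha>] pos[of \<alpha>] pos[of "- \<alpha>"] uminus_root[of \<alpha>]
      by (cases "level c \<alpha>" "0 :: int" rule: linorder_cases)
        (auto simp: max_parabolic_def L N level_uminus)
  qed (use sub in \<open>auto simp: max_parabolic_def\<close>)
  then show ?thesis using c by blast
qed

end

section \<open>The standard parabolic set and the Weyl group\<close>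

lemma eps_del_apply [simp]:
  "(s *\<^sub>w \<alpha>) x = s * \<alpha> x"
  "eps i (Eps j) = (if i = j then 1 else 0)" "eps i (Del k) = 0"
  "del k (Eps j) = 0" "del k (Del l) = (if k = l then 1 else 0)"
  by (auto simp: eps_def del_def wscale_def)

lemma one_wscale [simp]: "1 *\<^sub>w \<alpha> = \<alpha>"
  by (simp add: wscale_def)

context odd_orthosymplectic
begin

lemma level_0: "1 \<le> m \<Longrightarrow> level 0 \<alpha> = \<alpha> (Eps 1)"
  by (simp add: coord_level_def)

lemma P_osp_levi_eq:
  assumes "1 \<le> m"
  shows "P_osp_levi m n = {\<alpha> \<in> roots m n. level 0 \<alpha> = 0}"
proof (intro subset_antisym subsetI)
  have range: "i \<in> {2..m} \<Longrightarrow> i \<in> {1..m}" for i by auto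
  have rng: "i \<in> {2..m} \<Longrightarrow> i \<noteq> 1" for i by auto
  fix \<alpha> assume "\<alpha> \<in> P_osp_levi m n"
  then have "\<alpha> \<in> roots m n \<and> \<alpha> (Eps 1) = 0"
    unfolding P_osp_levi_def
    by (elim UnE CollectE exE conjE; simp only:)
      (intro conjI rootsI range; (assumption | simp add: rng del: insert_iff))+
  then show "\<alpha> \<in> {\<alpha> \<in> roots m n. level 0 \<alpha> = 0}" by (simp add: level_0[OF assms])
next
  have range: "i \<in> {2..m}" if "i \<in> {1..m}" "i \<noteq> 1" for i using that by auto
  have sz: "s \<noteq> 0" if "s \<in> signs" for s :: int using that by auto
  fix \<alpha> assume "\<alpha> \<in> {\<alpha> \<in> roots m n. level 0 \<alpha> = 0}"
  then have "\<alpha> \<in> roots m n" and z: "\<alpha> (Eps 1) = 0"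
    by (auto simp: level_0[OF assms])
  from this(1) show "\<alpha> \<in> P_osp_levi m n"
  proof (cases rule: roots_cases)
    case (1 s t i j)
    then have "i \<noteq> 1" "j \<noteq> 1" using z sz by (auto split: if_splits)
    with 1 range have "i \<in> {2..m}" "j \<in> {2..m}" by blast+
    with 1 show ?thesis unfolding P_osp_levi_def by blast
  next
    case (2 s i)
    then have "i \<noteq> 1" using z sz by (auto split: if_splits)
    with 2 range have "i \<in> {2..m}" by blast
    with 2 show ?thesis unfolding P_osp_levi_def by blast
  next
    case (3 s t k l)
    then show ?thesis unfolding P_osp_levi_def by blast
  next
    case (4 s k)
    then show ?thesis unfolding P_osp_levi_def by blast
  next
    case (5 s t i k)
    then have "i \<noteq> 1" using z sz by (auto split: if_splits)
    with 5 range have "i \<in> {2..m}" by blast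
    with 5 show ?thesis unfolding P_osp_levi_def by blast
  next
    case (6 s k)
    then show ?thesis unfolding P_osp_levi_def by blast
  qed
qed

lemma P_osp_nil_eq:
  assumes "1 \<le> m"
  shows "P_osp_nil m n = {\<alpha> \<in> roots m n. level 0 \<alpha> = 1}"
proof (intro subset_antisym subsetI)
  fix \<alpha> assume "\<alpha> \<in> P_osp_nil m n"
  then have "\<alpha> \<in> roots m n \<and> \<alpha> (Eps 1) = 1"
    unfolding P_osp_nil_def
    using rootsI(1)[of 1 1 1] rootsI(1)[of 1 "- 1" 1] rootsI(2)[of 1 1] rootsI(5)[of 1 1 1] rootsI(5)[of 1 "- 1" 1] assms by auto
  then show "\<alpha> \<in> {\<alpha> \<in> roots m n. level 0 \<alpha> = 1}" by (simp add: level_0[OF assms])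
next
  have range: "i \<in> {2..m}" if "i \<in> {1..m}" "i \<noteq> 1" for i using that by auto
  fix \<alpha> assume "\<alpha> \<in> {\<alpha> \<in> roots m n. level 0 \<alpha> = 1}"
  then have "\<alpha> \<in> roots m n" and z: "\<alpha> (Eps 1) = 1"
    by (auto simp: level_0[OF assms])
  from this(1) show "\<alpha> \<in> P_osp_nil m n"
  proof (cases rule: roots_cases)
    case (1 s t i j)
    then consider "i = 1" "s = 1" "j \<noteq> 1" | "j = 1" "t = 1" "i \<noteq> 1"
      using z by (cases "i = 1"; cases "j = 1") (auto split: if_splits)
    then show ?thesis
    proof cases
      case c: 1
      then have "j \<in> {2..m}" using 1 range by blast
      then show ?thesis using 1(2,6) c unfolding P_osp_nil_def one_wscale by auto
    next
      case c: 2
      then have "i \<in> {2..m}" using 1 range by blast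
      then show ?thesis using 1(1,6) c unfolding P_osp_nil_def one_wscale by (auto simp: add.commute)
    qed
  next
    case (2 s i)
    then have "i = 1" "s = 1" using z by (auto split: if_splits)
    with 2 show ?thesis unfolding P_osp_nil_def by simp
  next
    case (5 s t i k)
    then have "i = 1" "s = 1" using z by (auto split: if_splits)
    with 5 show ?thesis unfolding P_osp_nil_def by auto
  qed (use z in auto)
qed

text \<open>Index 0 has the weight \<open>\<epsilon>\<^sub>1\<close>.\<close>

lemma P_osp_eq:
  assumes "1 \<le> m"
  shows "P_osp m n = max_parabolic 0"
proof -
  have "0 < p" "0 \<noteq> m" using assms p_eq by auto
  then have "0 \<le> level 0 \<alpha> \<longleftrightarrow> level 0 \<alpha> = 0 \<or> level 0 \<alpha> = 1" if "\<alpha> \<in> roots m n" for \<alpha>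
    using level_root[of 0 \<alpha>] that by auto
  then show ?thesis
    unfolding P_osp_def P_osp_levi_eq[OF assms] P_osp_nil_eq[OF assms] max_parabolic_def by auto
qed

text \<open>The Weyl group element that exchanges \<open>\<epsilon>\<^sub>1\<close> with \<open>s \<epsilon>\<^sub>i\<close>, the weight of
  the even index \<open>c\<close>. The sign \<open>s\<close> is attached to both coordinates, so that the element is an involution
  also for \<open>i \<noteq> 1\<close>.\<close>

definition reflection :: "nat \<Rightarrow> weight \<Rightarrow> weight" where
  "reflection c =
    (let i = (if c < m then c + 1 else p - c); s = (if c < m then 1 else - 1) in
     (\<lambda>\<alpha> x. case x of
         Eps j \<Rightarrow> (if j = 1 \<or> j = i then s else 1) * \<alpha> (Eps (transpose 1 i j))
       | Del k \<Rightarrow> 1 * \<alpha> (Del (id k))))"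

text \<open>The reflection turns the coordinate along \<open>wt c\<close> into the one along \<open>\<epsilon>\<^sub>1\<close> and maps roots
  to roots. This gives one inclusion between the two parabolic sets; the other follows because it is an involution.\<close>

lemma reflection_maps_max_parabolic:
  assumes c: "c < p" "c \<noteq> m"
  shows "reflection c \<in> weyl_group m n" "reflection c ` max_parabolic c = max_parabolic 0"
proof -
  define i s where is_def: "i = (if c < m then c + 1 else p - c)" "s = (if c < m then 1 else - 1 :: int)"
  have i: "i \<in> {1..m}" and s: "s \<in> signs" and m: "1 \<le> m"
    using c p_eq by (auto simp: is_def)
  define \<sigma> where "\<sigma> = transpose 1 i"
  define u where "u = (\<lambda>j. if j = 1 \<or> j = i then s else 1)"
  have \<sigma>: "\<sigma> permutes {1..m}"
    unfolding \<sigma>_def using i m by (intro permutes_swap_id) auto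
  have \<sigma>\<sigma>: "\<sigma> (\<sigma> j) = j" for j by (simp add: \<sigma>_def)
  have u\<sigma>: "u (\<sigma> j) = u j" for j by (auto simp: u_def \<sigma>_def transpose_def)
  have u: "u j \<in> signs" "j \<notin> {1..m} \<Longrightarrow> u j = 1" for j
    using s i m by (auto simp: u_def)
  have uu: "u j * u j = 1" "u j * (u j * y) = y" for j y using u(1)[of j] by auto
  let ?w = "reflection c"
  have w: "?w = (\<lambda>\<alpha> x. case x of Eps j \<Rightarrow> u j * \<alpha> (Eps (\<sigma> j)) | Del k \<Rightarrow> 1 * \<alpha> (Del (id k)))"
    unfolding reflection_def is_def(1)[symmetric] is_def(2)[symmetric] Let_def u_def \<sigma>_def ..
  have w_Eps: "?w \<alpha> (Eps j) = u j * \<alpha> (Eps (\<sigma> j))" and w_Del: "?w \<alpha> (Del k) = \<alpha> (Del k)" for \<alpha> j k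
    by (simp_all add: w)
  show "?w \<in> weyl_group m n"
    unfolding weyl_group_def w
    apply (rule CollectI)
    apply (rule exI[of _ \<sigma>], rule exI[of _ id], rule exI[of _ u], rule exI[of _ "\<lambda>_. 1"])
    using \<sigma> u by (auto simp: permutes_id)
  have ext: "\<alpha> = \<beta>" if "\<And>j. \<alpha> (Eps j) = \<beta> (Eps j)" "\<And>k. \<alpha> (Del k) = \<beta> (Del k)" for \<alpha> \<beta> :: weight
  proof
    fix x show "\<alpha> x = \<beta> x" using that by (cases x) auto
  qed
  have invol: "?w (?w \<alpha>) = \<alpha>" for \<alpha>
    by (rule ext) (simp_all add: w_Eps w_Del u\<sigma> \<sigma>\<sigma> uu)
  have add: "?w (\<alpha> + \<beta>) = ?w \<alpha> + ?w \<beta>" for \<alpha> \<beta>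
    by (rule ext) (simp_all add: w_Eps w_Del algebra_simps)
  have w_eps: "?w (t *\<^sub>w eps j) = (t * u j) *\<^sub>w eps (\<sigma> j)" for t j
    by (rule ext) (use u\<sigma> \<sigma>\<sigma> in \<open>auto simp: w_Eps w_Del\<close>)
  have w_del: "?w (t *\<^sub>w del j) = t *\<^sub>w del j" for t j
    by (rule ext) (auto simp: w_Eps w_Del)
  have su: "t * u j \<in> signs" if "t \<in> signs" for t j using that u(1)[of j] by auto
  have \<sigma>_in: "\<sigma> j \<in> {1..m}" if "j \<in> {1..m}" for j using that \<sigma> by (metis permutes_in_image)
  have \<sigma>_neq: "\<sigma> j \<noteq> \<sigma> j'" if "j \<noteq> j'" for j j' using that \<sigma>\<sigma> by metis
  have root: "?w \<alpha> \<in> roots m n" if "\<alpha> \<in> roots m n" for \<alpha>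
    using that
    by (cases rule: roots_cases; simp only: add w_eps w_del)
      (intro rootsI su \<sigma>_in \<sigma>_neq; assumption)+
  have lev: "level 0 (?w \<alpha>) = level c \<alpha>" for \<alpha>
    unfolding level_0[OF m] w_Eps using c by (auto simp: u_def \<sigma>_def coord_level_def is_def)
  show "?w ` max_parabolic c = max_parabolic 0"
  proof (intro subset_antisym subsetI)
    fix \<alpha> assume "\<alpha> \<in> max_parabolic 0"
    then have "?w \<alpha> \<in> max_parabolic c"
      using root lev[of "?w \<alpha>"] by (simp add: max_parabolic_def invol)
    then show "\<alpha> \<in> ?w ` max_parabolic c" by (metis image_eqI invol)
  qed (use root lev in \<open>auto simp: max_parabolic_def\<close>)
qed

section \<open>Sums of root spaces as matrices with prescribed support\<close>

text \<open>Root spaces, Levi subalgebras and nilradicals all consist of the orthosymplectic matrices whose nonzero entries occupy prescribed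
  positions.\<close>

definition osp_supported :: "(nat \<Rightarrow> nat \<Rightarrow> bool) \<Rightarrow> complex mat set" where
  "osp_supported R = {X \<in> osp p q. \<forall>a<p + q. \<forall>b<p + q. X $$ (a, b) \<noteq> 0 \<longrightarrow> R a b}"

lemma osp_supportedD:
  assumes "X \<in> osp_supported R"
  shows "X \<in> osp p q" "X \<in> carrier_mat (p + q) (p + q)"
    "\<lbrakk>a < p + q; b < p + q; \<not> R a b\<rbrakk> \<Longrightarrow> X $$ (a, b) = 0"
  using assms osp_carrier by (auto simp: osp_supported_def)

lemma osp_supported_cong:
  assumes "\<And>X a b. \<lbrakk>X \<in> osp p q; a < p + q; b < p + q; X $$ (a, b) \<noteq> 0\<rbrakk> \<Longrightarrow> R a b \<longleftrightarrow> S a b"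
  shows "osp_supported R = osp_supported S"
  using assms by (auto simp: osp_supported_def)

text \<open>The condition defining \<open>osp\<close> only links the entries at \<open>(a, b)\<close> and \<open>(b*, a*)\<close>, so erasing
  a set of positions closed under this involution stays inside \<open>osp\<close>.\<close>

lemma osp_supported_restrict:
  assumes X: "X \<in> osp_supported R"
    and Q: "\<And>a b. a < p + q \<Longrightarrow> b < p + q \<Longrightarrow> Q (dl b) (dl a) \<longleftrightarrow> Q a b"
  shows "mat (p + q) (p + q) (\<lambda>(a, b). if Q a b then X $$ (a, b) else 0) \<in>
    osp_supported (\<lambda>a b. R a b \<and> Q a b)" (is "?Y \<in> _")
proof -
  have "?Y $$ (dl j, dl i) = - osp_twist p q i j * ?Y $$ (i, j)" if "i < p + q" "j < p + q" for i j
    using osp_nth[OF osp_supportedD(1)[OF X] that] Q[OF that] that by simp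
  then have "?Y \<in> osp p q" unfolding osp_iff by simp
  moreover have "R a b \<and> Q a b" if "a < p + q" "b < p + q" "?Y $$ (a, b) \<noteq> 0" for a b
    using osp_supportedD(3)[OF X that(1,2)] that by (cases "Q a b") auto
  ultimately show ?thesis unfolding osp_supported_def by blast
qed

text \<open>The even block is skew with respect to the antidiagonal. This is why \<open>\<plusminus>2\<epsilon>\<^sub>i\<close> is not a root.\<close>

lemma osp_even_antidiagonal:
  assumes "X \<in> osp p q" "a < p"
  shows "X $$ (a, dl a) = 0"
proof -
  have "a < p + q" "dl a < p" using assms(2) by (auto simp: dual_index_def)
  then have "X $$ (a, dl a) = - X $$ (a, dl a)"
    using osp_nth[OF assms(1), of a "dl a"] assms(2) by (simp add: osp_twist_def form_sign_def)
  then show ?thesis by simp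
qed

lemma osp_entry_root:
  assumes "X \<in> osp p q" "a < p + q" "b < p + q" "X $$ (a, b) \<noteq> 0" "a \<noteq> b"
  shows "wt a - wt b \<in> roots m n"
proof -
  have "root_pair a (dl b)"
    using assms osp_even_antidiagonal[of X a] by (auto simp: root_pair_def)
  then show ?thesis using root_pair_sum[of a "dl b"] assms(3) by (simp add: wt_dual)
qed

lemma cartan_iff: "H \<in> cartan m n \<longleftrightarrow> H \<in> osp_supported (=)"
  unfolding cartan_def p_eq[symmetric] q_eq[symmetric] osp_supported_def
  using osp_carrier[of H p q] by (auto simp: diagonal_mat_def; blast)

lemma cartan_dual:
  assumes "H \<in> osp p q" "a < p + q"
  shows "H $$ (dl a, dl a) = - H $$ (a, a)"
  using osp_nth[OF assms(1) assms(2) assms(2)] by (auto simp: osp_twist_def)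

text \<open>A diagonal element of \<open>osp\<close> is determined by its entries at the indices of the \<open>\<epsilon>\<^sub>i\<close> and
  \<open>\<delta>\<^sub>k\<close>, since the entry at a dual index is the negative one.\<close>

lemma weight_eval_wt:
  assumes "H \<in> cartan m n" "a < p + q"
  shows "weight_eval m n (wt a) H = H $$ (a, a)"
proof -
  have osp: "H \<in> osp p q" using assms(1) by (simp add: cartan_iff osp_supportedD)
  have E: "weight_eval m n (s *\<^sub>w eps i) H = of_int s * H $$ (i - 1, i - 1)" if "i \<in> {1..m}" for s i
  proof -
    have "(\<Sum>j = 1..m. of_int ((s *\<^sub>w eps i) (Eps j)) * H $$ (j - 1, j - 1)) =
        (\<Sum>j = 1..m. if j = i then of_int s * H $$ (i - 1, i - 1) else 0)"
      by (intro sum.cong) auto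
    then have "weight_eval m n (s *\<^sub>w eps i) H =
        (\<Sum>j = 1..m. if j = i then of_int s * H $$ (i - 1, i - 1) else 0)"
      unfolding weight_eval_def by simp
    then show ?thesis using that by (simp del: One_nat_def)
  qed
  have D: "weight_eval m n (s *\<^sub>w del k) H = of_int s * H $$ (2 * m + k, 2 * m + k)" if "k \<in> {1..n}" for s k
  proof -
    have "(\<Sum>l = 1..n. of_int ((s *\<^sub>w del k) (Del l)) * H $$ (2 * m + l, 2 * m + l)) =
        (\<Sum>l = 1..n. if l = k then of_int s * H $$ (2 * m + k, 2 * m + k) else 0)"
      by (intro sum.cong) auto
    then have "weight_eval m n (s *\<^sub>w del k) H =
        (\<Sum>l = 1..n. if l = k then of_int s * H $$ (2 * m + k, 2 * m + k) else 0)"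
      unfolding weight_eval_def by simp
    then show ?thesis using that by (simp del: One_nat_def)
  qed
  show ?thesis
    using assms(2)
  proof (cases rule: index_cases)
    case 1
    have "H $$ (m, m) = - H $$ (m, m)" using cartan_dual[OF osp m_less(2)] by simp
    then show ?thesis using 1 by (simp add: weight_eval_def)
  next
    case (2 s i)
    have "eps_idx 1 i < p + q" using eps_idx(3)[of 1 i] 2 by simp
    then have "H $$ (eps_idx (- 1) i, eps_idx (- 1) i) = - H $$ (eps_idx 1 i, eps_idx 1 i)"
      using cartan_dual[OF osp, of "eps_idx 1 i"] eps_idx(5)[of 1 i] 2 by simp
    then have "H $$ (a, a) = of_int s * H $$ (eps_idx 1 i, eps_idx 1 i)"
      using 2 by auto
    then show ?thesis
      unfolding 2(3) eps_idx(1)[OF 2(1,2)] E[OF 2(2)] by (simp add: eps_index_def)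
  next
    case (3 s k)
    have "del_idx 1 k < p + q" using del_idx(3)[of 1 k] 3 by simp
    then have "H $$ (del_idx (- 1) k, del_idx (- 1) k) = - H $$ (del_idx 1 k, del_idx 1 k)"
      using cartan_dual[OF osp, of "del_idx 1 k"] del_idx(5)[of 1 k] 3 by simp
    then have "H $$ (a, a) = of_int s * H $$ (del_idx 1 k, del_idx 1 k)"
      using 3 by auto
    moreover have "del_idx 1 k = 2 * m + k" using p_eq by (simp add: del_index_def)
    ultimately show ?thesis
      unfolding 3(3) del_idx(1)[OF 3(1,2)] D[OF 3(2)] by simp
  qed
qed

lemma weight_eval_add: "weight_eval m n (\<alpha> + \<beta>) H = weight_eval m n \<alpha> H + weight_eval m n \<beta> H"
  by (simp add: weight_eval_def algebra_simps sum.distrib)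

lemma weight_eval_diff: "weight_eval m n (\<alpha> - \<beta>) H = weight_eval m n \<alpha> H - weight_eval m n \<beta> H"
  by (simp add: weight_eval_def algebra_simps sum_subtractf)

text \<open>The element of the Cartan subalgebra dual to the axis \<open>x\<close>: a root takes on it the value of its coordinate at
  \<open>x\<close>. These elements separate weights.\<close>

definition coordinate_cartan :: "axis \<Rightarrow> complex mat" where
  "coordinate_cartan x = mat (p + q) (p + q) (\<lambda>(a, b). if a = b then of_int (wt a x) else 0)"

lemma coordinate_cartan: "coordinate_cartan x \<in> cartan m n"
  unfolding cartan_iff osp_supported_def osp_iff
  by (auto simp: coordinate_cartan_def dual_eq_iff wt_dual osp_twist_def)

lemma weight_eval_coordinate:
  assumes "\<alpha> \<in> roots m n"
  shows "weight_eval m n \<alpha> (coordinate_cartan x) = of_int (\<alpha> x)"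
proof -
  obtain a b where ab: "root_pair a b" "\<alpha> = wt a + wt b" using assms by (rule roots_pairE)
  then have "a < p + q" "b < p + q" by (auto simp: root_pair_def)
  then show ?thesis
    unfolding ab(2) weight_eval_add
    by (simp add: weight_eval_wt[OF coordinate_cartan]) (simp add: coordinate_cartan_def)
qed

lemma superbracket_cartan_nth:
  assumes H: "H \<in> cartan m n" and X: "X \<in> carrier_mat (p + q) (p + q)" and ab: "a < p + q" "b < p + q"
  shows "superbracket p q H X $$ (a, b) = (H $$ (a, a) - H $$ (b, b)) * X $$ (a, b)"
proof -
  have Hs: "H \<in> osp_supported (=)" using H by (simp add: cartan_iff)
  have "superbracket p q H X $$ (a, b) = (\<Sum>c\<in>{0..<p + q}.
      H $$ (a, c) * X $$ (c, b) - swap_sign p a c b * X $$ (a, c) * H $$ (c, b))"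
    by (rule superbracket_nth[OF osp_supportedD(2)[OF Hs] X ab])
  also have "\<dots> = (\<Sum>c\<in>{0..<p + q}. (if c = a then H $$ (a, a) * X $$ (a, b) else 0) -
      (if c = b then X $$ (a, b) * H $$ (b, b) else 0))"
    using ab by (intro sum.cong refl) (auto simp: osp_supportedD(3)[OF Hs] swap_sign_def)
  also have "\<dots> = (H $$ (a, a) - H $$ (b, b)) * X $$ (a, b)"
    using ab by (simp add: sum_subtractf algebra_simps)
  finally show ?thesis .
qed

text \<open>A diagonal \<open>H\<close> multiplies the entry at \<open>(a, b)\<close> by \<open>(wt a - wt b)(H)\<close>, so a nonzero entry
  of a root vector for \<open>\<alpha>\<close> forces \<open>wt a - wt b\<close> to agree with \<open>\<alpha>\<close> on every
  Cartan element, hence coordinate by coordinate.\<close>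

lemma root_space_eq:
  assumes "\<alpha> \<in> roots m n"
  shows "root_space m n \<alpha> = osp_supported (\<lambda>a b. wt a - wt b = \<alpha>)"
proof (intro subset_antisym subsetI)
  fix X assume "X \<in> root_space m n \<alpha>"
  then have X: "X \<in> osp p q"
    and ev: "\<And>H. H \<in> cartan m n \<Longrightarrow> superbracket p q H X = weight_eval m n \<alpha> H \<cdot>\<^sub>m X"
    by (auto simp: root_space_def p_eq q_eq)
  have "wt a - wt b = \<alpha>" if ab: "a < p + q" "b < p + q" "X $$ (a, b) \<noteq> 0" for a b
  proof
    fix x
    let ?H = "coordinate_cartan x"
    have "(?H $$ (a, a) - ?H $$ (b, b)) * X $$ (a, b) = superbracket p q ?H X $$ (a, b)"
      using superbracket_cartan_nth[OF coordinate_cartan osp_carrier[OF X] ab(1,2)] by simp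
    also have "\<dots> = of_int (\<alpha> x) * X $$ (a, b)"
      unfolding ev[OF coordinate_cartan] weight_eval_coordinate[OF assms]
      using osp_carrier[OF X] ab by simp
    finally have "?H $$ (a, a) - ?H $$ (b, b) = of_int (\<alpha> x)" using ab(3) by simp
    then have "(of_int (wt a x - wt b x) :: complex) = of_int (\<alpha> x)"
      using ab by (simp add: coordinate_cartan_def)
    then show "(wt a - wt b) x = \<alpha> x" by (metis of_int_eq_iff minus_apply)
  qed
  then show "X \<in> osp_supported (\<lambda>a b. wt a - wt b = \<alpha>)" using X by (simp add: osp_supported_def)
next
  fix X assume Xs: "X \<in> osp_supported (\<lambda>a b. wt a - wt b = \<alpha>)"
  note X = osp_supportedD(2)[OF Xs]
  have "superbracket p q H X = weight_eval m n \<alpha> H \<cdot>\<^sub>m X" if H: "H \<in> cartan m n" for H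
  proof (rule eq_matI)
    fix a b assume "a < dim_row (weight_eval m n \<alpha> H \<cdot>\<^sub>m X)" "b < dim_col (weight_eval m n \<alpha> H \<cdot>\<^sub>m X)"
    then have ab: "a < p + q" "b < p + q" using X by auto
    have "(H $$ (a, a) - H $$ (b, b)) * X $$ (a, b) = weight_eval m n \<alpha> H * X $$ (a, b)"
    proof (cases "wt a - wt b = \<alpha>")
      case True
      then show ?thesis using ab weight_eval_wt[OF H] weight_eval_diff by metis
    next
      case False
      then show ?thesis using osp_supportedD(3)[OF Xs ab] by simp
    qed
    then show "superbracket p q H X $$ (a, b) = (weight_eval m n \<alpha> H \<cdot>\<^sub>m X) $$ (a, b)"
      using ab X superbracket_cartan_nth[OF H X ab] by simp
  qed (use X superbracket_carrier[OF osp_supportedD(2)[OF H[unfolded cartan_iff]] X] in auto)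
  then show "X \<in> root_space m n \<alpha>"
    using osp_supportedD(1)[OF Xs] by (simp add: root_space_def p_eq q_eq)
qed

lemma osp_supported_sum:
  assumes "finite S" "\<And>\<alpha>. \<alpha> \<in> S \<Longrightarrow> X \<alpha> \<in> osp_supported (R \<alpha>)"
  shows "mat (p + q) (p + q) (\<lambda>ij. \<Sum>\<alpha>\<in>S. X \<alpha> $$ ij) \<in> osp_supported (\<lambda>a b. \<exists>\<alpha>\<in>S. R \<alpha> a b)"
proof -
  have "(\<Sum>\<alpha>\<in>S. X \<alpha> $$ (dl j, dl i)) = - osp_twist p q i j * (\<Sum>\<alpha>\<in>S. X \<alpha> $$ (i, j))"
    if "i < p + q" "j < p + q" for i j
    using osp_nth[OF osp_supportedD(1)[OF assms(2)] that]
    by (simp add: sum_distrib_left)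
  moreover have "\<exists>\<alpha>\<in>S. R \<alpha> a b" if "a < p + q" "b < p + q" "(\<Sum>\<alpha>\<in>S. X \<alpha> $$ (a, b)) \<noteq> 0" for a b
    using that osp_supportedD(3)[OF assms(2)] by (metis (mono_tags, lifting) sum.neutral)
  ultimately show ?thesis by (auto simp: osp_supported_def osp_iff)
qed

text \<open>A matrix supported on differences of weights in \<open>S\<close> is the sum of its restrictions to the positions with a fixed
  difference.\<close>

lemma root_spaces_sum_eq:
  assumes "S \<subseteq> roots m n"
  shows "root_spaces_sum m n S = osp_supported (\<lambda>a b. wt a - wt b \<in> S)"
proof -
  have fin: "finite S" using assms finite_roots by (rule finite_subset)
  have rs: "root_space m n \<alpha> = osp_supported (\<lambda>a b. wt a - wt b = \<alpha>)" if "\<alpha> \<in> S" for \<alpha>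
    using that assms root_space_eq by blast
  have eq: "root_spaces_sum m n S = {mat (p + q) (p + q) (\<lambda>ij. \<Sum>\<alpha>\<in>S. X \<alpha> $$ ij) | X.
        \<forall>\<alpha>\<in>S. X \<alpha> \<in> root_space m n \<alpha>}"
    by (simp add: root_spaces_sum_def p_eq q_eq)
  show ?thesis
  proof (intro subset_antisym subsetI)
    fix Y assume "Y \<in> root_spaces_sum m n S"
    then obtain X where X: "Y = mat (p + q) (p + q) (\<lambda>ij. \<Sum>\<alpha>\<in>S. X \<alpha> $$ ij)"
      "\<And>\<alpha>. \<alpha> \<in> S \<Longrightarrow> X \<alpha> \<in> osp_supported (\<lambda>a b. wt a - wt b = \<alpha>)"
      unfolding eq using rs by blast
    show "Y \<in> osp_supported (\<lambda>a b. wt a - wt b \<in> S)"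
      using osp_supported_sum[of S X "\<lambda>\<alpha> a b. wt a - wt b = \<alpha>", OF fin X(2)] unfolding X(1) by simp
  next
    fix Y assume Y: "Y \<in> osp_supported (\<lambda>a b. wt a - wt b \<in> S)"
    define X where "X = (\<lambda>\<alpha>. mat (p + q) (p + q)
      (\<lambda>(a, b). if wt a - wt b = \<alpha> then Y $$ (a, b) else 0))"
    have "X \<alpha> \<in> osp_supported (\<lambda>a b. wt a - wt b = \<alpha>)" if "\<alpha> \<in> S" for \<alpha>
    proof -
      have "X \<alpha> \<in> osp_supported (\<lambda>a b. wt a - wt b \<in> S \<and> wt a - wt b = \<alpha>)"
        unfolding X_def by (rule osp_supported_restrict[OF Y]) (simp add: wt_dual)
      also have "\<dots> = osp_supported (\<lambda>a b. wt a - wt b = \<alpha>)"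
        using that by (intro osp_supported_cong) auto
      finally show ?thesis .
    qed
    then have "\<forall>\<alpha>\<in>S. X \<alpha> \<in> root_space m n \<alpha>" using rs by blast
    moreover have "Y = mat (p + q) (p + q) (\<lambda>ij. \<Sum>\<alpha>\<in>S. X \<alpha> $$ ij)"
    proof (rule eq_matI)
      fix a b assume "a < dim_row (mat (p + q) (p + q) (\<lambda>ij. \<Sum>\<alpha>\<in>S. X \<alpha> $$ ij))"
        "b < dim_col (mat (p + q) (p + q) (\<lambda>ij. \<Sum>\<alpha>\<in>S. X \<alpha> $$ ij))"
      then have ab: "a < p + q" "b < p + q" by auto
      then have "(\<Sum>\<alpha>\<in>S. X \<alpha> $$ (a, b)) = (\<Sum>\<alpha>\<in>S. if \<alpha> = wt a - wt b then Y $$ (a, b) else 0)"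
        by (intro sum.cong) (auto simp: X_def)
      also have "\<dots> = Y $$ (a, b)"
        using osp_supportedD(3)[OF Y ab] by (simp add: sum.delta[OF fin])
      finally show "Y $$ (a, b) = mat (p + q) (p + q) (\<lambda>ij. \<Sum>\<alpha>\<in>S. X \<alpha> $$ ij) $$ (a, b)"
        using ab by simp
    qed (use osp_supportedD(2)[OF Y] in auto)
    ultimately show "Y \<in> root_spaces_sum m n S" unfolding eq by blast
  qed
qed

text \<open>The Cartan subalgebra contributes the diagonal entries.\<close>

lemma levi_eq:
  assumes "levi_roots P \<subseteq> roots m n"
  shows "levi m n P = osp_supported (\<lambda>a b. a = b \<or> wt a - wt b \<in> levi_roots P)"
proof (intro subset_antisym subsetI)
  fix Z assume "Z \<in> levi m n P"
  then obtain H X where Z: "Z = H + X" and H: "H \<in> osp_supported (=)"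
    and X: "X \<in> osp_supported (\<lambda>a b. wt a - wt b \<in> levi_roots P)"
    unfolding levi_def root_spaces_sum_eq[OF assms] by (auto simp: cartan_iff)
  note c = osp_supportedD(2)[OF H] osp_supportedD(2)[OF X]
  have "a = b \<or> wt a - wt b \<in> levi_roots P" if "a < p + q" "b < p + q" "Z $$ (a, b) \<noteq> 0" for a b
  proof (rule ccontr)
    assume "\<not> ?thesis"
    then have "H $$ (a, b) = 0" "X $$ (a, b) = 0"
      using osp_supportedD(3)[OF H that(1,2)] osp_supportedD(3)[OF X that(1,2)] by auto
    then show False using that c by (simp add: Z)
  qed
  moreover have "Z \<in> osp p q"
    using osp_supportedD(1)[OF H] osp_supportedD(1)[OF X] c by (auto simp: osp_iff Z algebra_simps)
  ultimately show "Z \<in> osp_supported (\<lambda>a b. a = b \<or> wt a - wt b \<in> levi_roots P)"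
    by (simp add: osp_supported_def)
next
  fix Z assume Z: "Z \<in> osp_supported (\<lambda>a b. a = b \<or> wt a - wt b \<in> levi_roots P)"
  note c = osp_supportedD(2)[OF Z]
  define H where "H = mat (p + q) (p + q) (\<lambda>(a, b). if a = b then Z $$ (a, b) else 0)"
  define X where "X = mat (p + q) (p + q) (\<lambda>(a, b). if a = b then 0 else Z $$ (a, b))"
  have "H \<in> osp_supported (\<lambda>a b. (a = b \<or> wt a - wt b \<in> levi_roots P) \<and> a = b)"
    unfolding H_def by (rule osp_supported_restrict[OF Z]) (auto simp: dual_eq_iff)
  also have "\<dots> = osp_supported (=)" by (rule osp_supported_cong) auto
  finally have "H \<in> cartan m n" unfolding cartan_iff .
  moreover have "X \<in> osp_supported (\<lambda>a b. wt a - wt b \<in> levi_roots P)"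
  proof -
    have "X = mat (p + q) (p + q) (\<lambda>(a, b). if a \<noteq> b then Z $$ (a, b) else 0)"
      by (auto simp: X_def)
    also have "\<dots> \<in> osp_supported (\<lambda>a b. (a = b \<or> wt a - wt b \<in> levi_roots P) \<and> a \<noteq> b)"
      by (rule osp_supported_restrict[OF Z]) (auto simp: dual_eq_iff)
    also have "\<dots> \<subseteq> osp_supported (\<lambda>a b. wt a - wt b \<in> levi_roots P)"
      unfolding osp_supported_def by auto
    finally show ?thesis .
  qed
  moreover have "Z = H + X" using c by (auto simp: H_def X_def)
  ultimately show "Z \<in> levi m n P" unfolding levi_def root_spaces_sum_eq[OF assms] by blast
qed

text \<open>The degree of index \<open>c\<close> is 1, that of its dual is \<open>-1\<close>, all others have degree 0; for even \<open>c
  \<noteq> m\<close> this is the coordinate of \<open>wt a\<close> along \<open>wt c\<close>.\<close>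

definition grade :: "nat \<Rightarrow> nat \<Rightarrow> int" where
  "grade c a = (if a = c then 1 else if a = dl c then - 1 else 0)"

abbreviation graded :: "nat \<Rightarrow> int \<Rightarrow> complex mat set" where
  "graded c d \<equiv> osp_supported (\<lambda>a b. grade c a - grade c b = d)"

lemma level_wt_diff:
  "c < p \<Longrightarrow> c \<noteq> m \<Longrightarrow> a < p + q \<Longrightarrow> b < p + q \<Longrightarrow> level c (wt a - wt b) = grade c a - grade c b"
  by (simp add: level_diff level_wt grade_def)

lemma levi_max:
  assumes c: "c < p" "c \<noteq> m"
  shows "levi m n (max_parabolic c) = graded c 0"
proof -
  have "levi_roots (max_parabolic c) \<subseteq> roots m n" by (auto simp: levi_roots_max)
  then have "levi m n (max_parabolic c) =
      osp_supported (\<lambda>a b. a = b \<or> wt a - wt b \<in> levi_roots (max_parabolic c))"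
    by (rule levi_eq)
  also have "\<dots> = graded c 0"
  proof (rule osp_supported_cong)
    fix X a b assume X: "X \<in> osp p q" "a < p + q" "b < p + q" "X $$ (a, b) \<noteq> 0"
    show "a = b \<or> wt a - wt b \<in> levi_roots (max_parabolic c) \<longleftrightarrow> grade c a - grade c b = 0"
      using osp_entry_root[OF X] level_wt_diff[OF c X(2,3)]
      by (cases "a = b") (simp_all add: levi_roots_max)
  qed
  finally show ?thesis .
qed

lemma nilradical_max:
  assumes c: "c < p" "c \<noteq> m"
  shows "nilradical m n (max_parabolic c) = graded c 1"
proof -
  have "nil_roots (max_parabolic c) \<subseteq> roots m n" by (auto simp: nil_roots_max[OF c])
  then have "nilradical m n (max_parabolic c) =
      osp_supported (\<lambda>a b. wt a - wt b \<in> nil_roots (max_parabolic c))"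
    unfolding nilradical_def by (rule root_spaces_sum_eq)
  also have "\<dots> = graded c 1"
  proof (rule osp_supported_cong)
    fix X a b assume X: "X \<in> osp p q" "a < p + q" "b < p + q" "X $$ (a, b) \<noteq> 0"
    show "wt a - wt b \<in> nil_roots (max_parabolic c) \<longleftrightarrow> grade c a - grade c b = 1"
      using osp_entry_root[OF X] level_wt_diff[OF c X(2,3)]
      by (cases "a = b") (simp_all add: nil_roots_max[OF c] level_zero)
  qed
  finally show ?thesis .
qed

section \<open>Parabolic sets with abelian nilradical\<close>

lemma even_q: "even q"
  by (simp add: q_eq)

lemma osp_twist_dual:
  assumes "c < p" "a < p + q"
  shows "osp_twist p q c (dl a) = osp_twist p q a (dl c)"
proof -
  have "dl c < p" using assms by (auto simp: dual_index_def)
  then show ?thesis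
    using assms form_sign_dual[OF even_q assms(2)] dl_even_iff[OF assms(2)]
    by (auto simp: osp_twist_def idx_parity_def) (auto simp: form_sign_def)
qed

text \<open>The bracket has degree 2, so only its entry at \<open>(c, c*)\<close> could be nonzero. That entry is the difference of the sums
  \<open>\<Sum>\<^sub>e X\<^bsub>c e\<^esub> Y\<^bsub>e c*\<^esub>\<close> and \<open>\<Sum>\<^sub>e \<plusminus>Y\<^bsub>c e\<^esub> X\<^bsub>e c*\<^esub>\<close>.
  Expressing the first row by the last column, both become minus the value of the form on
  the columns \<open>c*\<close> of \<open>X\<close> and \<open>Y\<close>, and they agree because the form is supersymmetric.\<close>

lemma graded_1_abelian:
  assumes c: "c < p" "c \<noteq> m" and X: "X \<in> graded c 1" and Y: "Y \<in> graded c 1"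
  shows "superbracket p q X Y = 0\<^sub>m (p + q) (p + q)"
proof (rule eq_matI)
  note Xc = osp_supportedD(2)[OF X] and Yc = osp_supportedD(2)[OF Y]
  have cN: "c < p + q" using c by simp
  have "dl c \<noteq> c" using dl_eq_self_iff[OF cN] c by simp
  fix a b assume "a < dim_row (0\<^sub>m (p + q) (p + q) :: complex mat)" "b < dim_col (0\<^sub>m (p + q) (p + q) :: complex mat)"
  then have ab: "a < p + q" "b < p + q" by auto
  have zero: "U $$ (a, e) * V $$ (e, b) = 0"
    if "U \<in> graded c 1" "V \<in> graded c 1" "e < p + q" "\<not> (a = c \<and> b = dl c)" for U V e
  proof (rule ccontr)
    assume "\<not> ?thesis"
    then have "grade c a - grade c e = 1" "grade c e - grade c b = 1"
      using osp_supportedD(3)[OF that(1) ab(1) that(3)] osp_supportedD(3)[OF that(2) that(3) ab(2)] by auto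
    then have "grade c a - grade c b = 2" by simp
    then show False using that(4) by (auto simp: grade_def split: if_splits)
  qed
  have "superbracket p q X Y $$ (a, b) = 0"
  proof (cases "a = c \<and> b = dl c")
    case False
    have "X $$ (a, e) * Y $$ (e, b) - swap_sign p a e b * Y $$ (a, e) * X $$ (e, b) = 0"
      if "e < p + q" for e
      using zero[OF X Y that False] zero[OF Y X that False] by (simp only: mult.assoc) simp
    then show ?thesis
      unfolding superbracket_nth[OF Xc Yc ab] by (intro sum.neutral) simp
  next
    case True
    let ?t = "\<lambda>e. osp_twist p q c e"
    \<comment> \<open>Supersymmetry of the form: for odd \<open>e\<close> the first factor is \<open>-1\<close> and duality reverses the sign of the second, for even \<open>e\<close> both are trivial.\<close>
    have t_dual: "swap_sign p c e (dl c) * ?t (dl e) = ?t e" if "e < p + q" for e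
      using that c form_sign_dual[OF even_q that] dl_even_iff[OF that] dl_even_iff[OF cN]
      by (auto simp: swap_sign_def osp_twist_def idx_parity_def)
    have s_dual: "swap_sign p c (dl e) (dl c) = swap_sign p c e (dl c)" if "e < p + q" for e
      using that by (simp add: swap_sign_def)
    have "(\<Sum>e\<in>{0..<p + q}. swap_sign p c e (dl c) * Y $$ (c, e) * X $$ (e, dl c)) =
        (\<Sum>e\<in>{0..<p + q}. swap_sign p c e (dl c) * (- ?t e * Y $$ (dl e, dl c)) * X $$ (e, dl c))"
      using osp_nth'[OF osp_supportedD(1)[OF Y] cN] by (intro sum.cong) auto
    also have "\<dots> = (\<Sum>e\<in>{0..<p + q}. swap_sign p c (dl e) (dl c) *
        (- ?t (dl e) * Y $$ (dl (dl e), dl c)) * X $$ (dl e, dl c))"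
      by (rule sum_dual[symmetric])
    also have "\<dots> = (\<Sum>e\<in>{0..<p + q}. - ((swap_sign p c e (dl c) * ?t (dl e)) *
        (X $$ (dl e, dl c) * Y $$ (e, dl c))))"
      by (intro sum.cong) (auto simp: s_dual)
    also have "\<dots> = (\<Sum>e\<in>{0..<p + q}. (- ?t e * X $$ (dl e, dl c)) * Y $$ (e, dl c))"
      by (intro sum.cong) (auto simp: t_dual)
    also have "\<dots> = (\<Sum>e\<in>{0..<p + q}. X $$ (c, e) * Y $$ (e, dl c))"
      using osp_nth'[OF osp_supportedD(1)[OF X] cN] by (intro sum.cong) auto
    finally show ?thesis
      unfolding superbracket_nth[OF Xc Yc ab] using True by (simp add: sum_subtractf)
  qed
  then show "superbracket p q X Y $$ (a, b) = 0\<^sub>m (p + q) (p + q) $$ (a, b)" using ab by simp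
qed (use superbracket_carrier[OF osp_supportedD(2)[OF X] osp_supportedD(2)[OF Y]] in auto)

lemma cominuscule_max:
  assumes c: "c < p" "c \<noteq> m"
  shows "cominuscule m n (max_parabolic c)"
  unfolding cominuscule_def nilradical_max[OF c]
  using graded_1_abelian[OF c] by (simp add: p_eq q_eq)

text \<open>A root vector for the short root \<open>wt r\<close>: it maps the basis vector of weight 0 to that of weight \<open>wt r\<close>,
  and the second entry is then dictated by \<open>osp_iff\<close>.\<close>

definition short_vector :: "nat \<Rightarrow> complex mat" where
  "short_vector r = mat (p + q) (p + q) (\<lambda>(a, b).
     if a = r \<and> b = m then 1 else if a = m \<and> b = dl r then - osp_twist p q r m else 0)"

lemma short_vector_nth:
  "a < p + q \<Longrightarrow> b < p + q \<Longrightarrow> short_vector r $$ (a, b) =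
    (if a = r \<and> b = m then 1 else if a = m \<and> b = dl r then - osp_twist p q r m else 0)"
  by (simp add: short_vector_def)

lemma short_vector_supported:
  assumes r: "r < p + q" "r \<noteq> m"
  shows "short_vector r \<in> osp_supported (\<lambda>a b. wt a - wt b = wt r)"
proof -
  have tw: "osp_twist p q m (dl r) = osp_twist p q r m"
    using osp_twist_dual[OF m_less(1) r(1)] by simp
  have "short_vector r $$ (dl j, dl i) = - osp_twist p q i j * short_vector r $$ (i, j)"
    if ij: "i < p + q" "j < p + q" for i j
  proof -
    have 1: "dl j = r \<longleftrightarrow> j = dl r" "dl i = dl r \<longleftrightarrow> i = r" using r ij by (metis dual_dual)+
    have 2: "dl j = m \<longleftrightarrow> j = m" "dl i = m \<longleftrightarrow> i = m" using ij by auto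
    have 3: "dl r \<noteq> m" using r by simp
    show ?thesis
      unfolding short_vector_nth[OF dual_less[OF ij(2)] dual_less[OF ij(1)]] short_vector_nth[OF ij] 1 2
      using r 3 tw by auto
  qed
  moreover have "wt a - wt b = wt r"
    if "a < p + q" "b < p + q" "short_vector r $$ (a, b) \<noteq> 0" for a b
    using that r by (auto simp: short_vector_nth wt_dual split: if_splits)
  ultimately show ?thesis
    unfolding osp_supported_def osp_iff by (simp add: short_vector_def)
qed

text \<open>The product of the two vectors contributes a sign at \<open>(r, t*)\<close>. The product in the opposite order reaches this
  position only for \<open>r = t\<close>, and for odd \<open>r\<close> it adds to the first one instead of cancelling it.\<close>

lemma short_vectors_bracket:
  assumes r: "r < p + q" "r \<noteq> m" and t: "t < p + q" "t \<noteq> m" and "r \<noteq> t \<or> p \<le> r"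
  shows "superbracket p q (short_vector r) (short_vector t) $$ (r, dl t) \<noteq> 0"
proof -
  note R = osp_supportedD(2)[OF short_vector_supported[OF r]]
    and T = osp_supportedD(2)[OF short_vector_supported[OF t]]
  have tN: "dl t < p + q" using t by simp
  let ?s = "swap_sign p r m (dl t)"
  have "superbracket p q (short_vector r) (short_vector t) $$ (r, dl t) =
     (\<Sum>e\<in>{0..<p + q}. if e = m then - osp_twist p q t m +
        (if r = t then ?s * osp_twist p q r m else 0) else 0)"
    unfolding superbracket_nth[OF R T r(1) tN]
    using r t m_less dual_eq_iff[OF r(1) t(1)]
    by (intro sum.cong) (auto simp: short_vector_nth)
  also have "\<dots> = - osp_twist p q t m + (if r = t then ?s * osp_twist p q r m else 0)"
    using m_less by simp
  also have "\<dots> \<noteq> 0"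
  proof (cases "r = t")
    case True
    then have "?s = - 1" using assms(5) r m_less dl_even_iff[OF t(1)] by (simp add: swap_sign_def idx_parity_def)
    then have sum: "- osp_twist p q t m + (if r = t then ?s * osp_twist p q r m else 0) = - (2 * osp_twist p q t m)"
      using True by simp
    show ?thesis unfolding sum by simp
  next
    case False
    then show ?thesis by simp
  qed
  finally show ?thesis .
qed

text \<open>The bracket of the two short root vectors would not vanish otherwise.\<close>

lemma cominuscule_short_roots:
  assumes P: "P \<subseteq> roots m n" and com: "cominuscule m n P"
    and r: "r < p + q" "wt r \<in> nil_roots P" and t: "t < p + q" "wt t \<in> nil_roots P"
  shows "r = t \<and> r < p"
proof (rule ccontr)
  assume no: "\<not> (r = t \<and> r < p)"
  have sub: "nil_roots P \<subseteq> roots m n" using P by (auto simp: nil_roots_def)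
  have "0 \<notin> nil_roots P" by (auto simp: nil_roots_def image_iff)
  then have rt: "r \<noteq> m" "t \<noteq> m" using r t by auto
  have nil: "short_vector s \<in> nilradical m n P" if "s < p + q" "s \<noteq> m" "wt s \<in> nil_roots P" for s
    unfolding nilradical_def root_spaces_sum_eq[OF sub]
    using short_vector_supported[OF that(1,2)] that(3) unfolding osp_supported_def by auto
  have "superbracket p q (short_vector r) (short_vector t) = 0\<^sub>m (p + q) (p + q)"
    using com nil[of r] nil[of t] r t rt unfolding cominuscule_def p_eq[symmetric] q_eq[symmetric] by blast
  then show False
    using short_vectors_bracket[OF r(1) rt(1) t(1) rt(2)] no r(1) t(1) by auto
qed

lemma cominuscule_parabolic_classification:
  assumes "parabolic m n P" "cominuscule m n P"
  shows "\<exists>c<p. c \<noteq> m \<and> P = max_parabolic c"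
proof (rule parabolic_eq_max[OF assms(1)])
  have "P \<subseteq> roots m n" using assms(1) by (auto simp: parabolic_def)
  then show "a = b \<and> a < p"
    if "a < p + q" "b < p + q" "wt a \<in> nil_roots P" "wt b \<in> nil_roots P" for a b
    using cominuscule_short_roots[OF _ assms(2)] that by blast
qed

end

section \<open>Levi subalgebra and nilradical\<close>

text \<open>The increasing enumeration of the natural numbers other than \<open>lo\<close> and \<open>hi\<close>, for \<open>lo < hi\<close>,
  and its inverse.\<close>

definition skip :: "nat \<Rightarrow> nat \<Rightarrow> nat \<Rightarrow> nat" where
  "skip lo hi e = (if e < lo then e else if e + 1 < hi then e + 1 else e + 2)"

definition unskip :: "nat \<Rightarrow> nat \<Rightarrow> nat \<Rightarrow> nat" where
  "unskip lo hi a = (if a < lo then a else if a < hi then a - 1 else a - 2)"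

locale odd_orthosymplectic_node = odd_orthosymplectic +
  fixes c r :: nat
  assumes c: "c < p" "c \<noteq> m" and p_r: "p = r + 2"
begin

abbreviation emb :: "nat \<Rightarrow> nat" where
  "emb \<equiv> skip (min c (dl c)) (max c (dl c))"

abbreviation unemb :: "nat \<Rightarrow> nat" where
  "unemb \<equiv> unskip (min c (dl c)) (max c (dl c))"

lemma cN: "c < p + q" "dl c < p + q" "dl c < p" "dl c \<noteq> c"
  using c dl_eq_self_iff[of c] by (auto simp: dl_even_iff)

lemma lo_hi: obtains lo hi where "min c (dl c) = lo" "max c (dl c) = hi" "lo < hi" "hi = r + 1 - lo"
    "lo \<le> r" "{c, dl c} = {lo, hi}"
proof (rule that[of "min c (dl c)" "max c (dl c)"])
  have "dl c = p - 1 - c" using c by (simp add: dual_index_def)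
  then show "max c (dl c) = r + 1 - min c (dl c)" "min c (dl c) \<le> r"
    using c p_r by auto
  show "min c (dl c) < max c (dl c)" using cN by auto
qed auto

text \<open>Deleting \<open>c\<close> and its dual leaves the index set of \<open>V\<^bsup>2m-1|2n\<^esup>\<close> together with its form: the
  enumeration is increasing and its range is stable under duality, so that duality, parity and the signs of the Gram matrix are
  all inherited.\<close>

lemma emb:
  assumes e: "e < r + q"
  shows "emb e < p + q" "emb e \<noteq> c" "emb e \<noteq> dl c" "unemb (emb e) = e"
    "emb e < p \<longleftrightarrow> e < r" "emb (dual_index r q e) = dl (emb e)" "form_sign p q (emb e) = form_sign r q e"
proof -
  obtain lo hi where lh: "min c (dl c) = lo" "max c (dl c) = hi" "lo < hi" "hi = r + 1 - lo"
    "lo \<le> r" "{c, dl c} = {lo, hi}" by (rule lo_hi)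
  show "emb e < p + q" "unemb (emb e) = e" "emb e < p \<longleftrightarrow> e < r"
    unfolding lh(1,2) using e lh(3-5) p_r by (auto simp: skip_def unskip_def)
  have "emb e \<notin> {c, dl c}"
    unfolding lh(1,2,6) using lh(3) by (auto simp: skip_def)
  then show "emb e \<noteq> c" "emb e \<noteq> dl c" by auto
  show d: "emb (dual_index r q e) = dl (emb e)"
    unfolding lh(1,2) using e lh(3-5) p_r by (auto simp: skip_def dual_index_def)
  have "e < dual_index r q e \<longleftrightarrow> emb e < emb (dual_index r q e)"
    unfolding lh(1,2) using lh(3) by (auto simp: skip_def)
  then show "form_sign p q (emb e) = form_sign r q e"
    using \<open>emb e < p \<longleftrightarrow> e < r\<close> by (simp add: form_sign_def d)
qed

lemma unemb:
  assumes "a < p + q" "a \<noteq> c" "a \<noteq> dl c"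
  shows "unemb a < r + q" "emb (unemb a) = a"
proof -
  obtain lo hi where lh: "min c (dl c) = lo" "max c (dl c) = hi" "lo < hi" "hi = r + 1 - lo"
    "lo \<le> r" "{c, dl c} = {lo, hi}" by (rule lo_hi)
  have "a \<noteq> lo" "a \<noteq> hi" using assms lh(6) by blast+
  then show "unemb a < r + q" "emb (unemb a) = a"
    unfolding lh(1,2) using assms(1) lh(3-5) p_r by (auto simp: skip_def unskip_def)
qed

lemma index_split:
  assumes "a < p + q"
  obtains "a = c" | "a = dl c" | e where "e < r + q" "a = emb e"
  using assms unemb by metis

lemma idx_parity_emb: "e < r + q \<Longrightarrow> idx_parity p (emb e) = idx_parity r e"
  by (simp add: idx_parity_def emb(5))

lemma osp_twist_emb:
  "e < r + q \<Longrightarrow> f < r + q \<Longrightarrow> osp_twist p q (emb e) (emb f) = osp_twist r q e f"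
  using emb(5)[of f] by (simp add: osp_twist_def emb not_less[symmetric] del: not_less)

lemma swap_sign_emb:
  "e < r + q \<Longrightarrow> f < r + q \<Longrightarrow> g < r + q \<Longrightarrow>
    swap_sign p (emb e) (emb f) (emb g) = swap_sign r e f g"
  by (simp add: swap_sign_def idx_parity_emb)

lemma grade_simps [simp]: "grade c c = 1" "grade c (dl c) = - 1" "e < r + q \<Longrightarrow> grade c (emb e) = 0"
  using cN by (auto simp: grade_def emb)

lemma sum_emb:
  assumes "f c = 0" "f (dl c) = 0"
  shows "(\<Sum>e\<in>{0..<p + q}. f e) = (\<Sum>e\<in>{0..<r + q}. f (emb e) :: complex)"
proof -
  have inj: "inj_on emb {0..<r + q}" using emb(4) by (intro inj_on_inverseI[where g = unemb]) auto
  have "(\<Sum>e\<in>{0..<r + q}. f (emb e)) = (\<Sum>e\<in>emb ` {0..<r + q}. f e)"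
    by (simp add: sum.reindex[OF inj])
  also have "\<dots> = (\<Sum>e\<in>{0..<p + q}. f e)"
  proof (rule sum.mono_neutral_left)
    show "\<forall>e\<in>{0..<p + q} - emb ` {0..<r + q}. f e = 0"
    proof
      fix e assume e: "e \<in> {0..<p + q} - emb ` {0..<r + q}"
      then have "e < p + q" by simp
      then show "f e = 0" by (cases rule: index_split) (use e assms in auto)
    qed
  qed (use emb(1) in auto)
  finally show ?thesis by simp
qed

text \<open>A matrix of degree 0 is block diagonal with blocks at \<open>c\<close>, at \<open>c*\<close> and in the middle. The entry at
  \<open>c*\<close> is minus the one at \<open>c\<close>.\<close>

definition levi_map :: "complex mat \<Rightarrow> complex mat \<times> complex" where
  "levi_map X = (mat (r + q) (r + q) (\<lambda>(i, j). X $$ (emb i, emb j)), X $$ (c, c))"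

definition levi_inv :: "complex mat \<times> complex \<Rightarrow> complex mat" where
  "levi_inv Z = mat (p + q) (p + q) (\<lambda>(a, b).
     if a = c \<and> b = c then snd Z else if a = dl c \<and> b = dl c then - snd Z
     else if a \<in> {c, dl c} \<or> b \<in> {c, dl c} then 0 else fst Z $$ (unemb a, unemb b))"

text \<open>A matrix of degree 1 has nonzero entries only in row \<open>c\<close> and in column \<open>c*\<close>, and these determine each
  other; the column is the part on which the middle block acts from the left.\<close>

definition nil_map :: "complex mat \<Rightarrow> complex vec" where
  "nil_map X = vec (r + q) (\<lambda>i. X $$ (emb i, dl c))"

definition nil_inv :: "complex vec \<Rightarrow> complex mat" where
  "nil_inv v = mat (p + q) (p + q) (\<lambda>(a, b).
     if b = dl c \<and> a \<notin> {c, dl c} then v $ unemb a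
     else if a = c \<and> b \<notin> {c, dl c} then - osp_twist p q c b * v $ unemb (dl b) else 0)"

lemma levi_inv_nth:
  "levi_inv Z $$ (c, c) = snd Z" "levi_inv Z $$ (dl c, dl c) = - snd Z"
  "levi_inv Z $$ (c, dl c) = 0" "levi_inv Z $$ (dl c, c) = 0"
  "e < r + q \<Longrightarrow> levi_inv Z $$ (emb e, c) = 0" "e < r + q \<Longrightarrow> levi_inv Z $$ (emb e, dl c) = 0"
  "e < r + q \<Longrightarrow> levi_inv Z $$ (c, emb e) = 0" "e < r + q \<Longrightarrow> levi_inv Z $$ (dl c, emb e) = 0"
  "e < r + q \<Longrightarrow> f < r + q \<Longrightarrow> levi_inv Z $$ (emb e, emb f) = fst Z $$ (e, f)"
  using cN emb(1-4) by (simp_all add: levi_inv_def)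

lemma nil_inv_nth:
  "nil_inv v $$ (c, c) = 0" "nil_inv v $$ (dl c, dl c) = 0"
  "nil_inv v $$ (c, dl c) = 0" "nil_inv v $$ (dl c, c) = 0"
  "e < r + q \<Longrightarrow> nil_inv v $$ (emb e, c) = 0" "e < r + q \<Longrightarrow> nil_inv v $$ (emb e, dl c) = v $ e"
  "e < r + q \<Longrightarrow> nil_inv v $$ (c, emb e) = - osp_twist p q c (emb e) * v $ (dual_index r q e)"
  "e < r + q \<Longrightarrow> nil_inv v $$ (dl c, emb e) = 0"
  "e < r + q \<Longrightarrow> f < r + q \<Longrightarrow> nil_inv v $$ (emb e, emb f) = 0"
proof -
  have "unemb (dl (emb e)) = dual_index r q e" if "e < r + q" for e
    using emb(4)[of "dual_index r q e"] emb(6)[OF that] that by simp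
  then show "e < r + q \<Longrightarrow> nil_inv v $$ (c, emb e) = - osp_twist p q c (emb e) * v $ (dual_index r q e)"
    using cN emb(1-3) by (simp add: nil_inv_def)
qed (use cN emb(1-4) in \<open>simp_all add: nil_inv_def\<close>)

lemma all_index: "(\<forall>a<p + q. P a) \<longleftrightarrow> P c \<and> P (dl c) \<and> (\<forall>e<r + q. P (emb e))"
proof
  assume R: "P c \<and> P (dl c) \<and> (\<forall>e<r + q. P (emb e))"
  show "\<forall>a<p + q. P a"
  proof (intro allI impI)
    fix a assume "a < p + q"
    then show "P a" by (cases rule: index_split) (use R in auto)
  qed
qed (use cN emb(1) in auto)

lemma dl_dl_c: "dl (dl c) = c"
  using cN by simp

lemma dl_emb: "e < r + q \<Longrightarrow> dl (emb e) = emb (dual_index r q e)"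
  by (simp add: emb(6))

lemma levi_map_osp:
  assumes "X \<in> graded c 0"
  shows "fst (levi_map X) \<in> osp r q"
proof -
  have "X $$ (emb (dual_index r q j), emb (dual_index r q i)) = - osp_twist r q i j * X $$ (emb i, emb j)"
    if "i < r + q" "j < r + q" for i j
    using osp_nth[OF osp_supportedD(1)[OF assms], of "emb i" "emb j"] that
    by (simp add: emb(1) dl_emb osp_twist_emb)
  then show ?thesis by (simp add: osp_iff levi_map_def)
qed

lemma levi_inv_graded:
  assumes "fst Z \<in> osp r q"
  shows "levi_inv Z \<in> graded c 0"
proof -
  have tw: "osp_twist p q c c = 1" "osp_twist p q (dl c) (dl c) = 1"
    using cN by (auto simp: osp_twist_def)
  have "levi_inv Z \<in> osp p q"
    unfolding osp_iff all_index
    using osp_nth[OF assms]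
    by (simp add: levi_inv_nth dl_dl_c dl_emb osp_twist_emb tw) (simp add: levi_inv_def)
  then show ?thesis
    unfolding osp_supported_def all_index by (simp add: levi_inv_nth)
qed

lemma eq_by_index:
  assumes "X \<in> carrier_mat (p + q) (p + q)" "Y \<in> carrier_mat (p + q) (p + q)"
    "\<forall>a<p + q. \<forall>b<p + q. X $$ (a, b) = Y $$ (a, b)"
  shows "X = Y"
  by (rule eq_matI) (use assms in auto)

lemma levi_bij: "bij_betw levi_map (graded c 0) (osp r q \<times> UNIV)"
proof (rule bij_betwI[where g = levi_inv])
  show "levi_map \<in> graded c 0 \<rightarrow> osp r q \<times> UNIV"
    using levi_map_osp by (auto simp: mem_Times_iff)
  show "levi_inv \<in> osp r q \<times> UNIV \<rightarrow> graded c 0"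
    using levi_inv_graded by (auto simp: mem_Times_iff)
next
  fix X assume X: "X \<in> graded c 0"
  note z = osp_supportedD(3)[OF X]
  have "X $$ (dl c, dl c) = - X $$ (c, c)"
    using cartan_dual[OF osp_supportedD(1)[OF X] cN(1)] .
  then have "\<forall>a<p + q. \<forall>b<p + q. levi_inv (levi_map X) $$ (a, b) = X $$ (a, b)"
    unfolding all_index by (simp add: levi_inv_nth levi_map_def z cN emb(1))
  then show "levi_inv (levi_map X) = X"
    by (intro eq_by_index) (simp_all add: levi_inv_def osp_supportedD(2)[OF X])
next
  fix Z assume "Z \<in> osp r q \<times> (UNIV :: complex set)"
  then have "fst Z \<in> carrier_mat (r + q) (r + q)" using osp_carrier by (auto simp: mem_Times_iff)
  then show "levi_map (levi_inv Z) = Z"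
    by (intro prod_eqI eq_matI) (auto simp: levi_map_def levi_inv_nth)
qed

lemma nil_inv_graded:
  assumes "v \<in> carrier_vec (r + q)"
  shows "nil_inv v \<in> graded c 1"
proof -
  have tw: "osp_twist p q (emb e) (dl c) = osp_twist p q c (emb (dual_index r q e))" if "e < r + q" for e
    using osp_twist_dual[OF c(1) emb(1)[OF that]] that by (simp add: dl_emb)
  have "nil_inv v \<in> osp p q"
    unfolding osp_iff all_index
    by (simp add: nil_inv_nth dl_dl_c dl_emb tw) (simp add: nil_inv_def)
  then show ?thesis
    unfolding osp_supported_def all_index by (simp add: nil_inv_nth)
qed

lemma nil_bij: "bij_betw nil_map (graded c 1) (carrier_vec (r + q))"
proof (rule bij_betwI[where g = nil_inv])
  show "nil_map \<in> graded c 1 \<rightarrow> carrier_vec (r + q)"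
    by (auto simp: nil_map_def)
  show "nil_inv \<in> carrier_vec (r + q) \<rightarrow> graded c 1"
    using nil_inv_graded by auto
next
  fix X assume X: "X \<in> graded c 1"
  note z = osp_supportedD(3)[OF X]
  have "X $$ (c, emb e) = - osp_twist p q c (emb e) * X $$ (emb (dual_index r q e), dl c)" if "e < r + q" for e
    using osp_nth'[OF osp_supportedD(1)[OF X] cN(1) emb(1)[OF that]] that by (simp add: dl_emb)
  then have "\<forall>a<p + q. \<forall>b<p + q. nil_inv (nil_map X) $$ (a, b) = X $$ (a, b)"
    unfolding all_index by (simp add: nil_inv_nth nil_map_def z cN emb(1))
  then show "nil_inv (nil_map X) = X"
    by (intro eq_by_index) (simp_all add: nil_inv_def osp_supportedD(2)[OF X])
next
  fix v :: "complex vec" assume "v \<in> carrier_vec (r + q)"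
  then show "nil_map (nil_inv v) = v"
    by (intro eq_vecI) (auto simp: nil_map_def nil_inv_nth)
qed

lemma levi_bracket:
  assumes X: "X \<in> graded c 0" and Y: "Y \<in> graded c 0"
  shows "levi_map (superbracket p q X Y) =
    (superbracket r q (fst (levi_map X)) (fst (levi_map Y)), 0)"
proof -
  note Xc = osp_supportedD(2)[OF X] and Yc = osp_supportedD(2)[OF Y]
  note x = osp_supportedD(3)[OF X] and y = osp_supportedD(3)[OF Y]
  have m: "fst (levi_map Z) \<in> carrier_mat (r + q) (r + q)" for Z by (simp add: levi_map_def)
  have "fst (levi_map (superbracket p q X Y)) =
      superbracket r q (fst (levi_map X)) (fst (levi_map Y))"
  proof (rule eq_matI)
    fix i j assume "i < dim_row (superbracket r q (fst (levi_map X)) (fst (levi_map Y)))"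
      "j < dim_col (superbracket r q (fst (levi_map X)) (fst (levi_map Y)))"
    then have ij: "i < r + q" "j < r + q" using superbracket_carrier[OF m m, of X Y] by auto
    have "fst (levi_map (superbracket p q X Y)) $$ (i, j) = superbracket p q X Y $$ (emb i, emb j)"
      using ij by (simp add: levi_map_def)
    also have "\<dots> = (\<Sum>e\<in>{0..<p + q}. X $$ (emb i, e) * Y $$ (e, emb j) -
        swap_sign p (emb i) e (emb j) * Y $$ (emb i, e) * X $$ (e, emb j))"
      by (rule superbracket_nth[OF Xc Yc emb(1)[OF ij(1)] emb(1)[OF ij(2)]])
    also have "\<dots> = (\<Sum>e\<in>{0..<r + q}. X $$ (emb i, emb e) * Y $$ (emb e, emb j) -
        swap_sign p (emb i) (emb e) (emb j) * Y $$ (emb i, emb e) * X $$ (emb e, emb j))"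
      by (rule sum_emb) (simp_all add: x y emb(1) cN ij)
    also have "\<dots> = superbracket r q (fst (levi_map X)) (fst (levi_map Y)) $$ (i, j)"
      unfolding superbracket_nth[OF m m ij]
      using ij by (intro sum.cong) (auto simp: levi_map_def swap_sign_emb)
    finally show "fst (levi_map (superbracket p q X Y)) $$ (i, j) =
        superbracket r q (fst (levi_map X)) (fst (levi_map Y)) $$ (i, j)" .
  qed (use carrier_matD[OF superbracket_carrier[OF m m, of X Y]] in \<open>simp_all add: levi_map_def\<close>)
  moreover have "superbracket p q X Y $$ (c, c) = (\<Sum>e\<in>{0..<p + q}. 0)"
    unfolding superbracket_nth[OF Xc Yc cN(1) cN(1)]
  proof (rule sum.cong)
    fix e assume "e \<in> {0..<p + q}"
    then have "e < p + q" by simp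
    then show "X $$ (c, e) * Y $$ (e, c) - swap_sign p c e c * Y $$ (c, e) * X $$ (e, c) = 0"
      by (cases rule: index_split) (simp_all add: x y emb(1) cN swap_sign_def)
  qed simp
  ultimately show ?thesis by (intro prod_eqI) (simp_all add: levi_map_def)
qed

text \<open>In \<open>X V - (\<plusminus>V X)\<close> the column \<open>c*\<close> of the first product is the middle block of
  \<open>X\<close> applied to the column of \<open>V\<close>. In the second product that column is multiplied by the entry of
  \<open>X\<close> at \<open>(c*, c*)\<close>, which is even, so no sign occurs, and is minus the entry at \<open>(c, c)\<close>.\<close>

lemma nil_action:
  assumes X: "X \<in> graded c 0" and V: "V \<in> graded c 1"
  shows "nil_map (superbracket p q X V) =
    fst (levi_map X) *\<^sub>v nil_map V + snd (levi_map X) \<cdot>\<^sub>v nil_map V"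
proof (rule eq_vecI)
  note Xc = osp_supportedD(2)[OF X] and Vc = osp_supportedD(2)[OF V]
  note x = osp_supportedD(3)[OF X] and v = osp_supportedD(3)[OF V]
  have m: "fst (levi_map X) \<in> carrier_mat (r + q) (r + q)" by (simp add: levi_map_def)
  have n: "nil_map V \<in> carrier_vec (r + q)" by (simp add: nil_map_def)
  have Xd: "X $$ (dl c, dl c) = - X $$ (c, c)"
    using cartan_dual[OF osp_supportedD(1)[OF X] cN(1)] .
  fix i assume "i < dim_vec (fst (levi_map X) *\<^sub>v nil_map V + snd (levi_map X) \<cdot>\<^sub>v nil_map V)"
  then have i: "i < r + q" by (simp add: nil_map_def)
  have "nil_map (superbracket p q X V) $ i = superbracket p q X V $$ (emb i, dl c)"
    using i by (simp add: nil_map_def)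
  also have "\<dots> = (\<Sum>e\<in>{0..<p + q}. X $$ (emb i, e) * V $$ (e, dl c) -
      swap_sign p (emb i) e (dl c) * V $$ (emb i, e) * X $$ (e, dl c))"
    by (rule superbracket_nth[OF Xc Vc emb(1)[OF i] cN(2)])
  also have "\<dots> = (\<Sum>e\<in>{0..<p + q}. X $$ (emb i, e) * V $$ (e, dl c)) -
      (\<Sum>e\<in>{0..<p + q}. swap_sign p (emb i) e (dl c) * V $$ (emb i, e) * X $$ (e, dl c))"
    by (rule sum_subtractf)
  also have "(\<Sum>e\<in>{0..<p + q}. X $$ (emb i, e) * V $$ (e, dl c)) =
      (\<Sum>e\<in>{0..<r + q}. X $$ (emb i, emb e) * V $$ (emb e, dl c))"
    by (rule sum_emb) (simp_all add: x i emb(1) cN)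
  also have "\<dots> = (fst (levi_map X) *\<^sub>v nil_map V) $ i"
    unfolding mult_mat_vec_nth[OF m n i] using i by (intro sum.cong) (auto simp: levi_map_def nil_map_def)
  also have "(\<Sum>e\<in>{0..<p + q}. swap_sign p (emb i) e (dl c) * V $$ (emb i, e) * X $$ (e, dl c)) =
      (\<Sum>e\<in>{0..<p + q}. if e = dl c then - (X $$ (c, c) * V $$ (emb i, dl c)) else 0)"
  proof (rule sum.cong)
    fix e assume "e \<in> {0..<p + q}"
    then have "e < p + q" by simp
    then show "swap_sign p (emb i) e (dl c) * V $$ (emb i, e) * X $$ (e, dl c) =
        (if e = dl c then - (X $$ (c, c) * V $$ (emb i, dl c)) else 0)"
      by (cases rule: index_split) (simp_all add: x cN cN(4)[symmetric] emb(1-3) swap_sign_def Xd)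
  qed simp
  also have "\<dots> = - (X $$ (c, c) * V $$ (emb i, dl c))"
    using cN by simp
  finally show "nil_map (superbracket p q X V) $ i =
      (fst (levi_map X) *\<^sub>v nil_map V + snd (levi_map X) \<cdot>\<^sub>v nil_map V) $ i"
    using i by (simp add: levi_map_def nil_map_def)
qed (simp add: nil_map_def)

lemma bij_betw_image_Int:
  assumes "bij_betw f A B" "\<And>x. x \<in> A \<Longrightarrow> x \<in> G \<longleftrightarrow> f x \<in> H"
  shows "f ` (A \<inter> G) = B \<inter> H"
  using assms unfolding bij_betw_def by blast

lemma levi_parity:
  assumes X: "X \<in> graded c 0" and d: "d \<in> {0, 1}"
  shows "X \<in> gl_part p q d \<longleftrightarrow>
    levi_map X \<in> gl_part r q d \<times> (if d = 0 then UNIV else {0})"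
proof -
  note x = osp_supportedD(3)[OF X]
  have Xd: "X $$ (dl c, dl c) = - X $$ (c, c)"
    using cartan_dual[OF osp_supportedD(1)[OF X] cN(1)] .
  have "(2 * k) mod 2 = (0 :: nat)" "(k + k) mod 2 = 0" for k :: nat by presburger+
  then show ?thesis
    unfolding gl_part_def all_index using d osp_supportedD(2)[OF X]
    by (auto simp: x cN emb(1) idx_parity_emb levi_map_def Xd)
qed

text \<open>The index \<open>c*\<close> is even, so the parity of an entry in its column is that of the row index; the entries in row
  \<open>c\<close> have the same parities as the corresponding ones in the column.\<close>

lemma nil_parity:
  assumes X: "X \<in> graded c 1" and d: "d \<in> {0, 1}"
  shows "X \<in> gl_part p q d \<longleftrightarrow> nil_map X \<in> vec_part r q d"
proof -
  note x = osp_supportedD(3)[OF X]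
  have pc: "idx_parity p c = 0" "idx_parity p (dl c) = 0" using cN c by (simp_all add: idx_parity_def)
  have pm: "idx_parity r e mod 2 = idx_parity r e" for e by (simp add: idx_parity_def)
  have row: "X $$ (c, emb e) = - osp_twist p q c (emb e) * X $$ (emb (dual_index r q e), dl c)" if "e < r + q" for e
    using osp_nth'[OF osp_supportedD(1)[OF X] cN(1) emb(1)[OF that]] that by (simp add: dl_emb)
  have "X \<in> gl_part p q d \<longleftrightarrow>
      (\<forall>e<r + q. idx_parity r e \<noteq> d \<longrightarrow> X $$ (c, emb e) = 0) \<and>
      (\<forall>e<r + q. idx_parity r e \<noteq> d \<longrightarrow> X $$ (emb e, dl c) = 0)"
    unfolding gl_part_def all_index using osp_supportedD(2)[OF X]
    by (auto simp: x cN emb(1) idx_parity_emb pc pm)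
  also have "\<dots> \<longleftrightarrow> (\<forall>e<r + q. idx_parity r e \<noteq> d \<longrightarrow> X $$ (emb e, dl c) = 0)"
    using idx_parity_dual[of _ r q] by (auto simp: row)
  also have "\<dots> \<longleftrightarrow> nil_map X \<in> vec_part r q d"
    by (simp add: vec_part_def nil_map_def)
  finally show ?thesis .
qed

lemma levi_iso:
  "lie_superalgebra_iso (sub_lsa p q (graded c 0))
    (direct_sum (sub_lsa r q (osp r q)) abelian_line) levi_map"
  unfolding lie_superalgebra_iso_def superspace_iso_def
proof (intro conjI ballI allI)
  let ?A = "sub_lsa p q (graded c 0)"
  let ?B = "direct_sum (sub_lsa r q (osp r q)) abelian_line"
  have A: "scarrier ?A = graded c 0" by (simp add: sub_lsa_def)
  have dims: "dim_row X = p + q" "dim_col X = p + q" if "X \<in> graded c 0" for X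
    using osp_supportedD(2)[OF that] by auto
  show "bij_betw levi_map (scarrier ?A) (scarrier ?B)"
    using levi_bij by (simp add: sub_lsa_def direct_sum_def abelian_line_def)
  show "levi_map (sadd ?A X Y) = sadd ?B (levi_map X) (levi_map Y)"
    if "X \<in> scarrier ?A" "Y \<in> scarrier ?A" for X Y
    using that dims[of Y] unfolding A
    by (auto simp: sub_lsa_def direct_sum_def abelian_line_def levi_map_def emb(1) cN)
  show "levi_map (sscale ?A k X) = sscale ?B k (levi_map X)" if "X \<in> scarrier ?A" for k X
    using that dims[of X] unfolding A
    by (auto simp: sub_lsa_def direct_sum_def abelian_line_def levi_map_def emb(1) cN)
  show "levi_map ` hpart ?A d = hpart ?B d" if "d \<in> {0, 1}" for d
  proof -
    have "levi_map ` (graded c 0 \<inter> gl_part p q d) =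
        (osp r q \<times> UNIV) \<inter> (gl_part r q d \<times> (if d = 0 then UNIV else {0}))"
      using that by (intro bij_betw_image_Int[OF levi_bij] levi_parity)
    then show ?thesis
      by (simp add: sub_lsa_def direct_sum_def abelian_line_def Times_Int_Times)
  qed
  show "levi_map (bracket ?A X Y) = bracket ?B (levi_map X) (levi_map Y)"
    if "X \<in> scarrier ?A" "Y \<in> scarrier ?A" for X Y
    using levi_bracket[of X Y] that unfolding A
    by (simp add: sub_lsa_def direct_sum_def abelian_line_def split_beta)
qed

lemma nil_iso:
  "supermodule_iso (sub_lsa p q (graded c 0))
    (sub_lsa p q (graded c 1)) (superbracket p q)
    (std_superspace r q) (\<lambda>x v. fst (levi_map x) *\<^sub>v v + snd (levi_map x) \<cdot>\<^sub>v v) nil_map"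
  unfolding supermodule_iso_def superspace_iso_def
proof (intro conjI ballI allI)
  let ?V = "sub_lsa p q (graded c 1)" and ?W = "std_superspace r q"
  have V: "scarrier ?V = graded c 1" by (simp add: sub_lsa_def)
  have dims: "dim_row X = p + q" "dim_col X = p + q" if "X \<in> graded c 1" for X
    using osp_supportedD(2)[OF that] by auto
  show "bij_betw nil_map (scarrier ?V) (scarrier ?W)"
    using nil_bij by (simp add: sub_lsa_def std_superspace_def)
  show "nil_map (sadd ?V X Y) = sadd ?W (nil_map X) (nil_map Y)"
    if "X \<in> scarrier ?V" "Y \<in> scarrier ?V" for X Y
    using that dims[of Y] unfolding V
    by (auto simp: sub_lsa_def std_superspace_def nil_map_def emb(1) cN)
  show "nil_map (sscale ?V k X) = sscale ?W k (nil_map X)" if "X \<in> scarrier ?V" for k X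
    using that dims[of X] unfolding V
    by (auto simp: sub_lsa_def std_superspace_def nil_map_def emb(1) cN)
  show "nil_map ` hpart ?V d = hpart ?W d" if "d \<in> {0, 1}" for d
  proof -
    have "nil_map ` (graded c 1 \<inter> gl_part p q d) = carrier_vec (r + q) \<inter> vec_part r q d"
      using that by (intro bij_betw_image_Int[OF nil_bij] nil_parity)
    then show ?thesis by (auto simp: sub_lsa_def std_superspace_def vec_part_def)
  qed
  show "nil_map (superbracket p q x v) =
      fst (levi_map x) *\<^sub>v nil_map v + snd (levi_map x) \<cdot>\<^sub>v nil_map v"
    if "x \<in> scarrier (sub_lsa p q (graded c 0))" "v \<in> scarrier ?V" for x v
    using that nil_action by (simp add: sub_lsa_def)
qed

end

theorem theorem2p7:
  fixes m n :: nat
  assumes "m \<ge> 1" and "n \<ge> 1"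
  shows "parabolic m n (P_osp m n) \<and> cominuscule m n (P_osp m n) \<and>
    levi_roots (P_osp m n) = P_osp_levi m n \<and> nil_roots (P_osp m n) = P_osp_nil m n \<and>
    (\<forall>P. parabolic m n P \<and> cominuscule m n P \<longrightarrow>
      (\<exists>w\<in>weyl_group m n. w ` P = P_osp m n) \<and>
      (\<exists>\<phi> \<psi>.
        lie_superalgebra_iso
          (sub_lsa (2 * m + 1) (2 * n) (levi m n P))
          (direct_sum (sub_lsa (2 * m - 1) (2 * n) (osp (2 * m - 1) (2 * n))) abelian_line) \<phi> \<and>
        supermodule_iso
          (sub_lsa (2 * m + 1) (2 * n) (levi m n P))
          (sub_lsa (2 * m + 1) (2 * n) (nilradical m n P)) (superbracket (2 * m + 1) (2 * n))
          (std_superspace (2 * m - 1) (2 * n))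
          (\<lambda>x v. fst (\<phi> x) *\<^sub>v v + snd (\<phi> x) \<cdot>\<^sub>v v) \<psi>))"
proof -
  interpret odd_orthosymplectic m n "2 * m + 1" "2 * n"
    by unfold_locales simp_all
  have 0: "0 < 2 * m + 1" "0 \<noteq> m" using assms(1) by auto
  note P = P_osp_eq[OF assms(1)]
  show ?thesis
  proof (intro conjI allI impI)
    show "parabolic m n (P_osp m n)" unfolding P by (rule parabolic_max[OF 0])
    show "cominuscule m n (P_osp m n)" unfolding P by (rule cominuscule_max[OF 0])
    show "levi_roots (P_osp m n) = P_osp_levi m n"
      unfolding P P_osp_levi_eq[OF assms(1)] by (rule levi_roots_max)
    show "nil_roots (P_osp m n) = P_osp_nil m n"
      unfolding P P_osp_nil_eq[OF assms(1)] by (rule nil_roots_max[OF 0])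
  next
    fix P assume "parabolic m n P \<and> cominuscule m n P"
    then obtain c where c: "c < 2 * m + 1" "c \<noteq> m" and Pc: "P = max_parabolic c"
      using cominuscule_parabolic_classification by blast
    show "\<exists>w\<in>weyl_group m n. w ` P = P_osp m n"
      unfolding P Pc using reflection_maps_max_parabolic[OF c] by blast
    interpret odd_orthosymplectic_node m n "2 * m + 1" "2 * n" c "2 * m - 1"
      using c assms(1) by unfold_locales auto
    show "\<exists>\<phi> \<psi>.
        lie_superalgebra_iso
          (sub_lsa (2 * m + 1) (2 * n) (levi m n P))
          (direct_sum (sub_lsa (2 * m - 1) (2 * n) (osp (2 * m - 1) (2 * n))) abelian_line) \<phi> \<and>
        supermodule_iso
          (sub_lsa (2 * m + 1) (2 * n) (levi m n P))
          (sub_lsa (2 * m + 1) (2 * n) (nilradical m n P)) (superbracket (2 * m + 1) (2 * n))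
          (std_superspace (2 * m - 1) (2 * n))
          (\<lambda>x v. fst (\<phi> x) *\<^sub>v v + snd (\<phi> x) \<cdot>\<^sub>v v) \<psi>"
      unfolding Pc levi_max[OF c] nilradical_max[OF c]
      using levi_iso nil_iso by blast
  qed
qed

end
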